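(* Let $A$ be a (discrete) abelian group. The following statements are equivalent: \begin{enumerate} \item $A$ is t-injective in $\Re$. \item $Ext_{t}(C,A)=0$ for all $C\in\Re$. \item $A\cong B\oplus D$ where $B$ is a torsion divisible group and $D$ is a torsion-free cotorsion group. \end{enumerate}
   Context: $\Re$ is the category of discrete abelian groups; all groups are in $\Re$. For a group $G$, $tG$ denotes its maximal torsion subgroup. $Ext(C,A)$ is the group of equivalence classes of extensions $0\to A\stackrel{\phi}{\to} B\stackrel{\psi}{\to} C\to 0$ (short exact sequences). Such an extension is a t-extension if the sequence of restricted maps $0\to tA\stackrel{\phi}{\to} tB\stackrel{\psi}{\to} tC\to 0$ is exact. $Ext_t(C,A)$ is the subgroup of $Ext(C,A)$ of elements represented by t-extensions. A group $G$ is t-injective in $\Re$ if for every t-extension $0\to X\stackrel{\phi}{\to} Y\to Z\to 0$ and every homomorphism $f:X\to G$ there is a homomorphism $\bar f:Y\to G$ with $\bar f\phi=f$. A group $G$ is cotorsion if $Ext(\mathbb{Q},G)=0$, where $\mathbb{Q}$ is the group of rationals. *)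

theory Defs
  imports Complex_Main "HOL-Algebra.Exact_Sequence"
begin

text \<open>
  Abelian groups are \<^locale>\<open>comm_group\<close>s, written multiplicatively; direct sums are \<open>\<times>\<times>\<close>.
\<close>

definition rat_group :: "rat monoid"
  where "rat_group = \<lparr>carrier = UNIV, monoid.mult = (+), one = 0\<rparr>"

definition torsion_part :: "'a monoid \<Rightarrow> 'a monoid"
  where "torsion_part G = G\<lparr>carrier := {x \<in> carrier G. \<exists>n::nat. n > 0 \<and> x [^]\<^bsub>G\<^esub> n = \<one>\<^bsub>G\<^esub>}\<rparr>"

definition torsion_group :: "'a monoid \<Rightarrow> bool"
  where "torsion_group G \<longleftrightarrow> carrier (torsion_part G) = carrier G"

definition torsion_free_group :: "'a monoid \<Rightarrow> bool"
  where "torsion_free_group G \<longleftrightarrow> carrier (torsion_part G) = {\<one>\<^bsub>G\<^esub>}"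

definition divisible_group :: "'a monoid \<Rightarrow> bool"
  where "divisible_group G \<longleftrightarrow>
    (\<forall>x \<in> carrier G. \<forall>n::nat. n > 0 \<longrightarrow> (\<exists>y \<in> carrier G. y [^]\<^bsub>G\<^esub> n = x))"

text \<open>
  \<^const>\<open>exact_seq\<close> forces all groups of a sequence to have the same element type.  Here the types
  must be allowed to differ (for instance, the right-hand group may be \<^const>\<open>rat_group\<close>).
\<close>

definition short_exact ::
    "'a monoid \<Rightarrow> 'b monoid \<Rightarrow> 'c monoid \<Rightarrow> ('a \<Rightarrow> 'b) \<Rightarrow> ('b \<Rightarrow> 'c) \<Rightarrow> bool"
  where "short_exact A B C \<phi> \<psi> \<longleftrightarrow>
    \<phi> \<in> hom A B \<and> \<psi> \<in> hom B C \<and>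
    inj_on \<phi> (carrier A) \<and> \<phi> ` carrier A = kernel B C \<psi> \<and> \<psi> ` carrier B = carrier C"

type_synonym ('a, 'b, 'c) extension = "'b monoid \<times> ('a \<Rightarrow> 'b) \<times> ('b \<Rightarrow> 'c)"

definition extension :: "'c monoid \<Rightarrow> 'a monoid \<Rightarrow> ('a, 'b, 'c) extension \<Rightarrow> bool"
  where "extension C A = (\<lambda>(B, \<phi>, \<psi>).
    comm_group A \<and> comm_group B \<and> comm_group C \<and> short_exact A B C \<phi> \<psi>)"

definition t_extension :: "'c monoid \<Rightarrow> 'a monoid \<Rightarrow> ('a, 'b, 'c) extension \<Rightarrow> bool"
  where "t_extension C A = (\<lambda>(B, \<phi>, \<psi>). extension C A (B, \<phi>, \<psi>) \<and>
    short_exact (torsion_part A) (torsion_part B) (torsion_part C) \<phi> \<psi>)"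

definition ext_equiv ::
    "'a monoid \<Rightarrow> ('a, 'b, 'c) extension \<Rightarrow> ('a, 'd, 'c) extension \<Rightarrow> bool"
  where "ext_equiv A = (\<lambda>(B, \<phi>, \<psi>) (B', \<phi>', \<psi>'). \<exists>h \<in> iso B B'.
    (\<forall>a \<in> carrier A. h (\<phi> a) = \<phi>' a) \<and> (\<forall>b \<in> carrier B. \<psi>' (h b) = \<psi> b))"

text \<open>
  Equivalence classes are formed among the extensions whose middle group has element type
  \<^typ>\<open>'a \<times> 'c\<close>.  This loses nothing: the middle group of an extension of \<open>C\<close> by \<open>A\<close> is always
  in bijection with \<open>carrier A \<times> carrier C\<close>, so every extension, of whatever type, is equivalent
  to one of this type (lemma \<open>ext_class_nonempty\<close> below).
\<close>

definition ext_class ::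
    "'c monoid \<Rightarrow> 'a monoid \<Rightarrow> ('a, 'b, 'c) extension \<Rightarrow> ('a, 'a \<times> 'c, 'c) extension set"
  where "ext_class C A E = {E'. extension C A E' \<and> ext_equiv A E' E}"

definition split_ext :: "'c monoid \<Rightarrow> 'a monoid \<Rightarrow> ('a, 'a \<times> 'c, 'c) extension"
  where "split_ext C A = (A \<times>\<times> C, \<lambda>a. (a, \<one>\<^bsub>C\<^esub>), snd)"

text \<open>
  The Baer sum: the pullback of \<open>\<psi>\<^sub>1\<close> and \<open>\<psi>\<^sub>2\<close> modulo the antidiagonal copy of \<open>A\<close>.
\<close>

definition baer_sum :: "'c monoid \<Rightarrow> 'a monoid \<Rightarrow> ('a, 'b, 'c) extension \<Rightarrow>
    ('a, 'd, 'c) extension \<Rightarrow> ('a, ('b \<times> 'd) set, 'c) extension"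
  where "baer_sum C A = (\<lambda>(B\<^sub>1, \<phi>\<^sub>1, \<psi>\<^sub>1) (B\<^sub>2, \<phi>\<^sub>2, \<psi>\<^sub>2).
    let P = (B\<^sub>1 \<times>\<times> B\<^sub>2)\<lparr>carrier := {(b\<^sub>1, b\<^sub>2) \<in> carrier B\<^sub>1 \<times> carrier B\<^sub>2. \<psi>\<^sub>1 b\<^sub>1 = \<psi>\<^sub>2 b\<^sub>2}\<rparr>;
        N = (\<lambda>a. (\<phi>\<^sub>1 a, inv\<^bsub>B\<^sub>2\<^esub> \<phi>\<^sub>2 a)) ` carrier A
    in (P Mod N, \<lambda>a. N #>\<^bsub>P\<^esub> (\<phi>\<^sub>1 a, \<one>\<^bsub>B\<^sub>2\<^esub>), \<lambda>S. THE c. \<exists>(b\<^sub>1, b\<^sub>2) \<in> S. c = \<psi>\<^sub>1 b\<^sub>1))"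

definition Ext :: "'c monoid \<Rightarrow> 'a monoid \<Rightarrow> ('a, 'a \<times> 'c, 'c) extension set monoid"
  where "Ext C A =
    \<lparr>carrier = ext_class C A ` {E :: ('a, 'a \<times> 'c, 'c) extension. extension C A E},
     monoid.mult = (\<lambda>X Y. \<Union>E\<^sub>1 \<in> X. \<Union>E\<^sub>2 \<in> Y. ext_class C A (baer_sum C A E\<^sub>1 E\<^sub>2)),
     one = ext_class C A (split_ext C A)\<rparr>"

definition Ext_t :: "'c monoid \<Rightarrow> 'a monoid \<Rightarrow> ('a, 'a \<times> 'c, 'c) extension set monoid"
  where "Ext_t C A = (Ext C A)\<lparr>carrier := {X \<in> carrier (Ext C A). \<exists>E \<in> X. t_extension C A E}\<rparr>"

definition cotorsion_group :: "'a monoid \<Rightarrow> bool"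
  where "cotorsion_group G \<longleftrightarrow> carrier (Ext rat_group G) = {\<one>\<^bsub>Ext rat_group G\<^esub>}"

text \<open>
  HOL cannot quantify over types inside a formula, so the test extensions range over the groups
  with elements in a type \<^typ>\<open>'u\<close>, which is a parameter and plays the role of a universe.
  A theorem that leaves \<^typ>\<open>'u\<close> free holds for every such universe.  Finite types have to be
  excluded: they do not even contain the countable groups.
\<close>

definition t_injective :: "'u itself \<Rightarrow> 'a monoid \<Rightarrow> bool"
  where "t_injective _ G \<longleftrightarrow>
    (\<forall>(X :: 'u monoid) (Y :: 'u monoid) (Z :: 'u monoid) \<phi> \<psi>. \<forall>f \<in> hom X G.
      t_extension Z X (Y, \<phi>, \<psi>) \<longrightarrow>
      (\<exists>g \<in> hom Y G. \<forall>x \<in> carrier X. g (\<phi> x) = f x))"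

lemma subgroup_torsion_part:
  fixes G :: "'a monoid" (structure)
  assumes "comm_group G"
  shows "subgroup (carrier (torsion_part G)) G"
proof -
  interpret comm_group G by fact
  show ?thesis
  proof
    show "carrier (torsion_part G) \<subseteq> carrier G" by (auto simp: torsion_part_def)
    show "\<one> \<in> carrier (torsion_part G)" by (auto simp: torsion_part_def intro: exI[of _ 1])
    show "inv x \<in> carrier (torsion_part G)" if "x \<in> carrier (torsion_part G)" for x
      using that by (auto simp: torsion_part_def nat_pow_inv)
    show "x \<otimes> y \<in> carrier (torsion_part G)"
      if xy: "x \<in> carrier (torsion_part G)" "y \<in> carrier (torsion_part G)" for x y
    proof -
      obtain m n :: nat where *: "x \<in> carrier G" "y \<in> carrier G" "m > 0" "n > 0"
        "x [^] m = \<one>" "y [^] n = \<one>"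
        using xy by (auto simp: torsion_part_def)
      then have "x [^] (m * n) = \<one>" "y [^] (n * m) = \<one>"
        by (metis nat_pow_one nat_pow_pow)+
      then have "(x \<otimes> y) [^] (m * n) = \<one>" 
        using * by (simp add: nat_pow_distrib mult.commute)
      then show ?thesis using * by (auto simp: torsion_part_def intro!: exI[of _ "m * n"])
    qed
  qed
qed

lemma ext_class_nonempty:
  fixes E :: "('a, 'b, 'c) extension"
  assumes "extension C A E"
  shows "ext_class C A E \<noteq> {}"
proof -
  obtain B \<phi> \<psi> where E: "E = (B, \<phi>, \<psi>)" by (cases E)
  from assms have se: "short_exact A B C \<phi> \<psi>" and cg: "comm_group A" "comm_group B" "comm_group C"
    by (auto simp: extension_def E)
  interpret A: comm_group A by fact
  interpret B: comm_group B by fact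
  interpret C: comm_group C by fact
  interpret p: group_hom B C \<psi>
    using se by unfold_locales (auto simp: short_exact_def)
  define s where "s = inv_into (carrier B) \<psi>"
  have s: "s (\<psi> b) \<in> carrier B" "\<psi> (s (\<psi> b)) = \<psi> b" if "b \<in> carrier B" for b
    using that unfolding s_def by (auto intro: inv_into_into f_inv_into_f)
  define g where "g b = (inv_into (carrier A) \<phi> (b \<otimes>\<^bsub>B\<^esub> inv\<^bsub>B\<^esub> s (\<psi> b)), \<psi> b)" for b
  have inj: "inj_on g (carrier B)"
  proof (rule inj_onI)
    fix b b' assume b: "b \<in> carrier B" "b' \<in> carrier B" and eq: "g b = g b'"
    have k: "x \<otimes>\<^bsub>B\<^esub> inv\<^bsub>B\<^esub> s (\<psi> x) \<in> \<phi> ` carrier A" if "x \<in> carrier B" for x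
      using that s[OF that] se by (simp add: short_exact_def kernel_def)
    have "\<psi> b = \<psi> b'" using eq by (simp add: g_def)
    moreover have "b \<otimes>\<^bsub>B\<^esub> inv\<^bsub>B\<^esub> s (\<psi> b) = b' \<otimes>\<^bsub>B\<^esub> inv\<^bsub>B\<^esub> s (\<psi> b')"
      using eq k[OF b(1)] k[OF b(2)] by (auto simp: g_def dest: inv_into_injective)
    ultimately show "b = b'" using b s by simp
  qed
  define r where "r = inv_into (carrier B) g"
  have r [simp]: "r (g b) = b" if "b \<in> carrier B" for b
    using inj that by (simp add: r_def)
  define B' where "B' = \<lparr>carrier = g ` carrier B, monoid.mult = (\<lambda>x y. g (r x \<otimes>\<^bsub>B\<^esub> r y)), one = g \<one>\<^bsub>B\<^esub>\<rparr>"
  have B': "comm_group B'"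
  proof (rule comm_groupI)
    show "\<exists>y\<in>carrier B'. y \<otimes>\<^bsub>B'\<^esub> x = \<one>\<^bsub>B'\<^esub>" if "x \<in> carrier B'" for x
      using that by (auto simp: B'_def intro!: bexI[of _ "inv\<^bsub>B\<^esub> _"])
  qed (auto simp: B'_def B.m_ac)
  have g: "g \<in> iso B B'"
    using inj by (auto simp: iso_def hom_def B'_def bij_betw_def)
  have r': "r \<in> iso B' B"
    using inj by (auto simp: iso_def hom_def B'_def bij_betw_def inj_on_def image_image)
  let ?E = "(B', g \<circ> \<phi>, \<psi> \<circ> r)"
  have \<phi>: "\<phi> a \<in> carrier B" if "a \<in> carrier A" for a
    using se that by (auto simp: short_exact_def hom_def)
  have ker: "kernel B' C (\<psi> \<circ> r) = g ` kernel B C \<psi>"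
    by (auto simp: kernel_def B'_def)
  have "short_exact A B' C (g \<circ> \<phi>) (\<psi> \<circ> r)"
    unfolding short_exact_def
  proof (intro conjI)
    show "g \<circ> \<phi> \<in> hom A B'" "\<psi> \<circ> r \<in> hom B' C"
      using se g r' by (auto simp: short_exact_def iso_def intro: hom_compose)
    show "inj_on (g \<circ> \<phi>) (carrier A)"
      using se inj by (auto simp: short_exact_def kernel_def intro!: comp_inj_on elim: inj_on_subset)
    show "(g \<circ> \<phi>) ` carrier A = kernel B' C (\<psi> \<circ> r)"
      using se by (simp only: ker short_exact_def image_comp [symmetric])
    have "r ` carrier B' = carrier B" by (auto simp: B'_def image_image)
    then show "(\<psi> \<circ> r) ` carrier B' = carrier C"
      using se by (simp only: short_exact_def image_comp [symmetric])
  qed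
  then have "extension C A ?E" using B' cg by (simp add: extension_def)
  moreover have "ext_equiv A ?E E"
    using \<phi> by (auto simp: ext_equiv_def E intro!: bexI[OF _ r'])
  ultimately show ?thesis by (auto simp: ext_class_def)
qed

end

theory Submission
  imports Defs "HOL-Algebra.Weak_Morphisms" "HOL-Library.Countable_Set"
begin

text \<open>
  A short exact sequence \<open>0 \<rightarrow> A \<rightarrow> B \<rightarrow> C \<rightarrow> 0\<close> represents the neutral element of
  \<open>Ext C A\<close> exactly if \<open>A\<close> is a retract of \<open>B\<close>, so the vanishing of \<open>Ext\<close>, of its t-part, and
  cotorsion are all statements that certain extensions split (\<open>Ext_trivial_iff\<close>,
  \<open>Ext_t_trivial_iff\<close>, \<open>cotorsion_group_iff\<close>).  Moreover an extension is a t-extension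
  as soon as every torsion element of \<open>C\<close> lifts to a torsion element of \<open>B\<close>
  (\<open>t_extension_iff\<close>).

  From the decomposition to the other two properties.  Let \<open>X \<rightarrow> Y \<rightarrow> Z\<close> be a t-extension.
  A homomorphism from \<open>X\<close> to a divisible group extends to \<open>Y\<close> because divisible groups are
  injective.  Let \<open>D\<close> be torsion-free and cotorsion, and let \<open>V\<close> and \<open>W\<close> be the rational
  hulls of \<open>D\<close> and \<open>Z\<close>.  A homomorphism \<open>f : X \<rightarrow> D\<close> extends to \<open>h : Y \<rightarrow> V\<close>.  Since \<open>V\<close>
  is torsion-free and torsion lifts from \<open>Z\<close> to \<open>Y\<close>, the class of \<open>h\<close> modulo \<open>D\<close> depends only on
  the image of \<open>Y\<close> in \<open>W\<close>, so it comes from a homomorphism \<open>\<mu> : W \<rightarrow> V/D\<close>.  Cotorsion allows \<open>\<mu>\<close> to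
  be lifted to \<open>V\<close> on each line of the rational vector space \<open>W\<close>, and Zorn's lemma turns
  this into a lift on all of \<open>W\<close> (\<open>cotorsion_lift_divisible\<close>).  Subtracting the lift from
  \<open>h\<close> gives an extension of \<open>f\<close> with values in \<open>D\<close>
  (\<open>torsion_free_cotorsion_extends\<close>).  Applied to the identity of \<open>A\<close> this splits
  every t-extension of any group by \<open>A\<close>, whatever the element types.

  Back to the decomposition.  Either property implies that every t-extension of a
  \<^emph>\<open>countable\<close> group \<open>C\<close> by \<open>A\<close> splits.  For t-injectivity the point is that such an extension
  is determined by a countable subextension, which fits into every infinite type, however
  large \<open>A\<close> is (\<open>t_injective_splits\<close>).  Two countable groups are
  enough: \<open>C = \<int>/n\<close> shows that every torsion element of \<open>A\<close> is divisible by \<open>n\<close>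
  (\<open>torsion_part_divisible_of_splits\<close>), and \<open>C = \<rat>\<close>, where every extension is a t-extension, shows
  that \<open>A\<close> is cotorsion.  Hence the torsion part is divisible, so it is a direct summand, and
  its complement inherits cotorsion
  (\<open>torsion_divisible_times_cotorsion_decomposition\<close>).
\<close>

section \<open>Preliminaries on direct products and subgroups\<close>

lemma DirProd_comm_group:
  assumes "comm_group G" "comm_group H"
  shows "comm_group (G \<times>\<times> H)"
proof -
  interpret G: comm_group G by fact
  interpret H: comm_group H by fact
  interpret group "G \<times>\<times> H" using G.is_group H.is_group by (rule DirProd_group)
  show ?thesis
    by (rule group_comm_groupI) (auto simp: G.m_comm H.m_comm)
qed

lemma DirProd_nat_pow [simp]:
  "(x, y) [^]\<^bsub>G \<times>\<times> H\<^esub> (k :: nat) = (x [^]\<^bsub>G\<^esub> k, y [^]\<^bsub>H\<^esub> k)"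
  by (induction k) auto

lemma DirProd_int_pow:
  assumes "group G" "group H" "x \<in> carrier G" "y \<in> carrier H"
  shows "(x, y) [^]\<^bsub>G \<times>\<times> H\<^esub> (k :: int) = (x [^]\<^bsub>G\<^esub> k, y [^]\<^bsub>H\<^esub> k)"
proof -
  interpret G: group G by fact
  interpret H: group H by fact
  show ?thesis
  proof (cases "k < 0")
    case True
    have "(x, y) [^]\<^bsub>G \<times>\<times> H\<^esub> k = inv\<^bsub>G \<times>\<times> H\<^esub> (x [^]\<^bsub>G\<^esub> nat (- k), y [^]\<^bsub>H\<^esub> nat (- k))"
      using True by (simp only: int_pow_def2 if_True DirProd_nat_pow)
    also have "\<dots> = (inv\<^bsub>G\<^esub> (x [^]\<^bsub>G\<^esub> nat (- k)), inv\<^bsub>H\<^esub> (y [^]\<^bsub>H\<^esub> nat (- k)))"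
      using assms by (intro inv_DirProd G.nat_pow_closed H.nat_pow_closed)
    finally show ?thesis using True by (simp only: int_pow_def2 if_True)
  next
    case False
    then show ?thesis by (simp only: int_pow_def2 if_False DirProd_nat_pow)
  qed
qed

lemma subgroup_imp_comm_group:
  assumes "comm_group G" and "subgroup H G"
  shows "comm_group (G\<lparr>carrier := H\<rparr>)"
proof -
  interpret comm_group G by fact
  have "group (G\<lparr>carrier := H\<rparr>)" using assms(2) by (rule subgroup_imp_group)
  then show ?thesis
    by (rule group.group_comm_groupI) (use subgroup.mem_carrier[OF assms(2)] in \<open>auto simp: m_comm\<close>)
qed

section \<open>Homomorphisms built from graphs\<close>

text \<open>
  The universal property of the quotient of \<open>U\<close> by the kernel of \<open>p\<close>, with that quotient
  identified with the image of \<open>p\<close>.  All homomorphisms below that are described by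
  their values on a parametrized set of elements are obtained from it.
\<close>

lemma hom_factor_through_image:
  assumes "group U" "group G" "group H" "p \<in> hom U G" "q \<in> hom U H"
    and ker: "\<And>u. u \<in> carrier U \<Longrightarrow> p u = \<one>\<^bsub>G\<^esub> \<Longrightarrow> q u = \<one>\<^bsub>H\<^esub>"
  shows "\<exists>f \<in> hom (G\<lparr>carrier := p ` carrier U\<rparr>) H. \<forall>u \<in> carrier U. f (p u) = q u"
proof -
  interpret U: group U by fact
  interpret p: group_hom U G p using assms by (simp add: group_hom_def group_hom_axioms_def)
  interpret q: group_hom U H q using assms by (simp add: group_hom_def group_hom_axioms_def)
  have eq: "q u = q v" if "u \<in> carrier U" "v \<in> carrier U" "p u = p v" for u v
  proof -
    have "q (u \<otimes>\<^bsub>U\<^esub> inv\<^bsub>U\<^esub> v) = \<one>\<^bsub>H\<^esub>" by (rule ker) (use that in auto)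
    then show ?thesis
      using that by (metis U.inv_closed q.H.inv_equality q.H.inv_inv q.hom_closed q.hom_inv q.hom_mult)
  qed
  define f where "f x = q (inv_into (carrier U) p x)" for x
  have f: "f (p u) = q u" if "u \<in> carrier U" for u
    unfolding f_def by (rule eq) (use that in \<open>auto intro: inv_into_into f_inv_into_f\<close>)
  have "f \<in> hom (G\<lparr>carrier := p ` carrier U\<rparr>) H"
  proof (rule homI)
    fix x y assume "x \<in> carrier (G\<lparr>carrier := p ` carrier U\<rparr>)" "y \<in> carrier (G\<lparr>carrier := p ` carrier U\<rparr>)"
    then obtain u v where "u \<in> carrier U" "v \<in> carrier U" "x = p u" "y = p v" by auto
    then show "f (x \<otimes>\<^bsub>G\<lparr>carrier := p ` carrier U\<rparr>\<^esub> y) = f x \<otimes>\<^bsub>H\<^esub> f y"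
      using f[of "u \<otimes>\<^bsub>U\<^esub> v"] f by simp
  qed (auto simp: f)
  then show ?thesis using f by blast
qed

text \<open>
  Apply the preceding lemma to the two projections of \<open>M\<close>: for a subgroup, being the graph of a
  function only has to be checked above the neutral element.
\<close>

lemma hom_of_graph:
  assumes G: "group G" "group H" and M: "subgroup M (G \<times>\<times> H)"
    and single: "\<And>h. (\<one>\<^bsub>G\<^esub>, h) \<in> M \<Longrightarrow> h = \<one>\<^bsub>H\<^esub>"
  shows "\<exists>f \<in> hom (G\<lparr>carrier := fst ` M\<rparr>) H. \<forall>(x, h) \<in> M. f x = h"
proof -
  have "group ((G \<times>\<times> H)\<lparr>carrier := M\<rparr>)"
    using G M by (simp add: DirProd_group group.subgroup_imp_group)
  moreover have "fst \<in> hom ((G \<times>\<times> H)\<lparr>carrier := M\<rparr>) G" "snd \<in> hom ((G \<times>\<times> H)\<lparr>carrier := M\<rparr>) H"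
    using subgroup.subset[OF M] by (auto simp: hom_def mult_DirProd')
  ultimately have "\<exists>f \<in> hom (G\<lparr>carrier := fst ` carrier ((G \<times>\<times> H)\<lparr>carrier := M\<rparr>)\<rparr>) H.
      \<forall>u \<in> carrier ((G \<times>\<times> H)\<lparr>carrier := M\<rparr>). f (fst u) = snd u"
    using G single by (intro hom_factor_through_image) auto
  then show ?thesis by (auto simp: case_prod_beta)
qed

text \<open>
  The kernel of the multiplication \<open>H \<times> K \<rightarrow> G\<close> is the antidiagonal copy of \<open>H \<inter> K\<close>, and there the two
  homomorphisms cancel.
\<close>

lemma hom_amalgamate:
  assumes G: "comm_group G" and T: "comm_group T" and H: "subgroup H G" and K: "subgroup K G"
    and f: "f \<in> hom (G\<lparr>carrier := H\<rparr>) T" and g: "g \<in> hom (G\<lparr>carrier := K\<rparr>) T"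
    and agree: "\<And>x. x \<in> H \<Longrightarrow> x \<in> K \<Longrightarrow> f x = g x"
  shows "\<exists>h \<in> hom (G\<lparr>carrier := H <#>\<^bsub>G\<^esub> K\<rparr>) T. \<forall>x \<in> H. \<forall>y \<in> K. h (x \<otimes>\<^bsub>G\<^esub> y) = f x \<otimes>\<^bsub>T\<^esub> g y"
proof -
  interpret G: comm_group G by fact
  interpret T: comm_group T by fact
  interpret H: subgroup H G by fact
  interpret K: subgroup K G by fact
  let ?U = "G\<lparr>carrier := H\<rparr> \<times>\<times> G\<lparr>carrier := K\<rparr>"
  let ?p = "\<lambda>(x, y). x \<otimes>\<^bsub>G\<^esub> y" and ?q = "\<lambda>(x, y). f x \<otimes>\<^bsub>T\<^esub> g y"
  have grp: "group (G\<lparr>carrier := H\<rparr>)" "group (G\<lparr>carrier := K\<rparr>)"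
    by (simp_all add: H.subgroup_is_group K.subgroup_is_group)
  interpret f: group_hom "G\<lparr>carrier := H\<rparr>" T f
    using f grp by (simp add: group_hom_def group_hom_axioms_def)
  interpret g: group_hom "G\<lparr>carrier := K\<rparr>" T g
    using g grp by (simp add: group_hom_def group_hom_axioms_def)
  have fc: "f x \<in> carrier T" if "x \<in> H" for x using f.hom_closed that by simp
  have gc: "g x \<in> carrier T" if "x \<in> K" for x using g.hom_closed that by simp
  have p: "?p \<in> hom ?U G" by (auto simp: hom_def G.m_ac)
  have "f (x \<otimes>\<^bsub>G\<^esub> x') = f x \<otimes>\<^bsub>T\<^esub> f x'" if "x \<in> H" "x' \<in> H" for x x'
    using f.hom_mult[of x x'] that by simp
  moreover have "g (x \<otimes>\<^bsub>G\<^esub> x') = g x \<otimes>\<^bsub>T\<^esub> g x'" if "x \<in> K" "x' \<in> K" for x x'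
    using g.hom_mult[of x x'] that by simp
  ultimately have q: "?q \<in> hom ?U T" using fc gc by (auto simp: hom_def T.m_ac)
  have "\<exists>h \<in> hom (G\<lparr>carrier := ?p ` carrier ?U\<rparr>) T. \<forall>u \<in> carrier ?U. h (?p u) = ?q u"
  proof (rule hom_factor_through_image[OF _ _ _ p q])
    show "group ?U" using grp by (rule DirProd_group)
    fix u assume u: "u \<in> carrier ?U" "?p u = \<one>\<^bsub>G\<^esub>"
    obtain x y where xy: "u = (x, y)" by (cases u)
    have "x \<in> H" "y \<in> K" "x \<otimes>\<^bsub>G\<^esub> y = \<one>\<^bsub>G\<^esub>" using u xy by auto
    then have x: "x = inv\<^bsub>G\<^esub> y" using G.inv_equality by auto
    then have "x \<in> K" using \<open>y \<in> K\<close> by auto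
    then have "f x = g x" using \<open>x \<in> H\<close> agree by auto
    then have "f x \<otimes>\<^bsub>T\<^esub> g y = g (x \<otimes>\<^bsub>G\<^esub> y)"
      using g.hom_mult[of x y] \<open>x \<in> K\<close> \<open>y \<in> K\<close> by simp
    also have "\<dots> = \<one>\<^bsub>T\<^esub>" using g.hom_one \<open>x \<otimes>\<^bsub>G\<^esub> y = \<one>\<^bsub>G\<^esub>\<close> by simp
    finally show "?q u = \<one>\<^bsub>T\<^esub>" using xy by simp
  qed (simp_all add: G.is_group T.is_group)
  moreover have "?p ` carrier ?U = H <#>\<^bsub>G\<^esub> K" by (auto simp: set_mult_def image_def)
  ultimately show ?thesis by auto
qed

lemma subgroup_Union_chain:
  assumes "group G" and "\<C> \<noteq> {}" and "subset.chain {H. subgroup H G} \<C>"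
  shows "subgroup (\<Union>\<C>) G"
proof -
  interpret group G by fact
  have sub: "subgroup H G" if "H \<in> \<C>" for H using assms(3) that by (auto simp: subset.chain_def)
  show ?thesis
  proof (rule subgroupI)
    show "\<Union>\<C> \<subseteq> carrier G" using sub subgroup.subset by blast
    show "\<Union>\<C> \<noteq> {}" using assms(2) sub subgroup.one_closed by (metis UnionI all_not_in_conv)
    show "inv\<^bsub>G\<^esub> x \<in> \<Union>\<C>" if "x \<in> \<Union>\<C>" for x using sub subgroup.m_inv_closed that by (metis Union_iff)
    show "x \<otimes>\<^bsub>G\<^esub> y \<in> \<Union>\<C>" if xy: "x \<in> \<Union>\<C>" "y \<in> \<Union>\<C>" for x y
    proof -
      obtain H K where HK: "H \<in> \<C>" "K \<in> \<C>" "x \<in> H" "y \<in> K" using xy by blast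
      then have "H \<subseteq> K \<or> K \<subseteq> H" using assms(3) by (auto simp: subset_chain_def)
      then show ?thesis
      proof
        assume "H \<subseteq> K"
        then have "x \<otimes>\<^bsub>G\<^esub> y \<in> K" using HK sub[of K] by (auto intro: subgroup.m_closed)
        then show ?thesis using HK by blast
      next
        assume "K \<subseteq> H"
        then have "x \<otimes>\<^bsub>G\<^esub> y \<in> H" using HK sub[of H] by (auto intro: subgroup.m_closed)
        then show ?thesis using HK by blast
      qed
    qed
  qed
qed

section \<open>Divisible groups are injective\<close>

text \<open>
  The one-step extension in Baer's argument: if \<open>M\<close> is the graph of a partial homomorphism
  to the divisible group \<open>T\<close>, then \<open>y\<close> can be given a value \<open>t\<close> compatible with the
  prescribed values on all powers of \<open>y\<close> in the domain.  These powers are generated by a least positive one,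
  of which \<open>t\<close> has to be a suitable root, or they are trivial and \<open>t\<close> is arbitrary.
\<close>

lemma cyclic_graph_extension:
  assumes G: "comm_group G" and T: "comm_group T" "divisible_group T"
    and M: "subgroup M (G \<times>\<times> T)" and single: "\<And>t. (\<one>\<^bsub>G\<^esub>, t) \<in> M \<Longrightarrow> t = \<one>\<^bsub>T\<^esub>"
    and y: "y \<in> carrier G"
  shows "\<exists>t \<in> carrier T. \<forall>k::int. \<forall>u. (y [^]\<^bsub>G\<^esub> k, u) \<in> M \<longrightarrow> t [^]\<^bsub>T\<^esub> k = u"
proof (cases "\<exists>k::nat. k > 0 \<and> y [^]\<^bsub>G\<^esub> k \<in> fst ` M")
  case False
  interpret G: comm_group G by fact
  interpret T: comm_group T by fact
  interpret P: group "G \<times>\<times> T" by (simp add: DirProd_group G.is_group T.is_group)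
  have "\<one>\<^bsub>T\<^esub> [^]\<^bsub>T\<^esub> k = u" if ku: "(y [^]\<^bsub>G\<^esub> k, u) \<in> M" for k :: int and u
  proof (cases "k = 0")
    case True
    then show ?thesis using ku single by simp
  next
    case k: False
    have "u \<in> carrier T" using subgroup.subset[OF M] ku by auto
    then have "inv\<^bsub>G \<times>\<times> T\<^esub> (y [^]\<^bsub>G\<^esub> k, u) = (y [^]\<^bsub>G\<^esub> (- k), inv\<^bsub>T\<^esub> u)"
      using y by (simp add: G.is_group T.is_group G.int_pow_neg)
    then have "(y [^]\<^bsub>G\<^esub> (- k), inv\<^bsub>T\<^esub> u) \<in> M" using subgroup.m_inv_closed[OF M ku] by simp
    then have "y [^]\<^bsub>G\<^esub> (nat \<bar>k\<bar>) \<in> fst ` M"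
      using ku by (cases "k \<ge> 0") (force simp: int_pow_int[symmetric])+
    then show ?thesis using False k by (metis zero_less_nat_eq zero_less_abs_iff)
  qed
  then show ?thesis by (intro bexI[of _ "\<one>\<^bsub>T\<^esub>"]) (blast, simp)
next
  case True
  interpret G: comm_group G by fact
  interpret T: comm_group T by fact
  interpret P: comm_group "G \<times>\<times> T" using G T(1) by (rule DirProd_comm_group)
  define n where "n = (LEAST k::nat. k > 0 \<and> y [^]\<^bsub>G\<^esub> k \<in> fst ` M)"
  have n: "n > 0" "y [^]\<^bsub>G\<^esub> n \<in> fst ` M"
    using LeastI_ex[OF True] by (auto simp: n_def)
  have least: "n \<le> k" if "k > 0" "y [^]\<^bsub>G\<^esub> k \<in> fst ` M" for k
    unfolding n_def by (rule Least_le) (use that in auto)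
  obtain s where s: "(y [^]\<^bsub>G\<^esub> n, s) \<in> M" using n by auto
  then have sT: "s \<in> carrier T" using subgroup.subset[OF M] by auto
  then obtain t where t: "t \<in> carrier T" "t [^]\<^bsub>T\<^esub> n = s"
    using T(2) n by (auto simp: divisible_group_def)
  have pow: "(x, z) [^]\<^bsub>G \<times>\<times> T\<^esub> k = (x [^]\<^bsub>G\<^esub> k, z [^]\<^bsub>T\<^esub> k)"
    if "x \<in> carrier G" "z \<in> carrier T" for x z and k :: int
    using that by (simp add: DirProd_int_pow)
  have "t [^]\<^bsub>T\<^esub> k = u" if ku: "(y [^]\<^bsub>G\<^esub> k, u) \<in> M" for k :: int and u
  proof -
    have uT: "u \<in> carrier T" using ku subgroup.subset[OF M] by auto
    \<comment> \<open>By minimality, \<open>n\<close> divides every exponent \<open>k\<close> with \<open>k\<close>-th power of \<open>y\<close> in the domain.\<close>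
    define q r where "q = k div int n" and "r = k mod int n"
    have k: "k = int n * q + r" "0 \<le> r" "r < int n" using n by (auto simp: q_def r_def)
    have "(y [^]\<^bsub>G\<^esub> n, s) [^]\<^bsub>G \<times>\<times> T\<^esub> (- q) \<in> M"
      using P.subgroup_int_pow_closed[OF M s] .
    then have "(y [^]\<^bsub>G\<^esub> (int n * (- q)), s [^]\<^bsub>T\<^esub> (- q)) \<in> M"
      using y sT by (simp add: pow flip: int_pow_int) (simp add: G.int_pow_pow)
    from subgroup.m_closed[OF M ku this]
    have r: "(y [^]\<^bsub>G\<^esub> r, u \<otimes>\<^bsub>T\<^esub> s [^]\<^bsub>T\<^esub> (- q)) \<in> M"
      using y k by (simp add: G.int_pow_mult[symmetric])
    have "r = 0"
    proof (rule ccontr)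
      assume "r \<noteq> 0"
      then have "nat r > 0" using k by simp
      moreover have "y [^]\<^bsub>G\<^esub> nat r \<in> fst ` M"
      proof -
        have "y [^]\<^bsub>G\<^esub> nat r = y [^]\<^bsub>G\<^esub> r" using k(2) by (metis int_pow_int nat_0_le)
        then show ?thesis using r by (metis fst_conv imageI)
      qed
      ultimately have "n \<le> nat r" by (rule least)
      then show False using k by linarith
    qed
    then have "u \<otimes>\<^bsub>T\<^esub> s [^]\<^bsub>T\<^esub> (- q) = \<one>\<^bsub>T\<^esub>" using r single by simp
    then have "u = s [^]\<^bsub>T\<^esub> q"
      using uT sT T.int_pow_closed[of s q] by (metis T.inv_equality T.inv_inv T.int_pow_neg T.inv_closed)
    also have "\<dots> = t [^]\<^bsub>T\<^esub> (int n * q)"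
      using t by (simp add: T.int_pow_pow[symmetric] int_pow_int)
    finally show ?thesis using k \<open>r = 0\<close> by simp
  qed
  then show ?thesis using t by blast
qed

text \<open>
  Baer's theorem.  Zorn's lemma is applied to the graphs of partial homomorphisms, ordered by
  inclusion, so that the union of a chain is again a subgroup of the product.
\<close>

theorem divisible_group_injective:
  assumes G: "comm_group G" and T: "comm_group T" "divisible_group T" and H: "subgroup H G"
    and f: "f \<in> hom (G\<lparr>carrier := H\<rparr>) T"
  shows "\<exists>g \<in> hom G T. \<forall>x \<in> H. g x = f x"
proof -
  interpret G: comm_group G by fact
  interpret T: comm_group T by fact
  interpret H: subgroup H G by fact
  interpret P: comm_group "G \<times>\<times> T" using G T(1) by (rule DirProd_comm_group)
  interpret f: group_hom "G\<lparr>carrier := H\<rparr>" T f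
    using f H.subgroup_is_group[OF G.is_group] T.is_group by (simp add: group_hom_def group_hom_axioms_def)
  define \<Gamma> where "\<Gamma> = (\<lambda>x. (x, f x)) ` H"
  define \<A> where "\<A> = {M. subgroup M (G \<times>\<times> T) \<and> \<Gamma> \<subseteq> M \<and> (\<forall>t. (\<one>\<^bsub>G\<^esub>, t) \<in> M \<longrightarrow> t = \<one>\<^bsub>T\<^esub>)}"
  have "(\<lambda>x. (x, f x)) \<in> hom (G\<lparr>carrier := H\<rparr>) (G \<times>\<times> T)"
    using f by (auto simp: hom_def)
  then have "group_hom (G\<lparr>carrier := H\<rparr>) (G \<times>\<times> T) (\<lambda>x. (x, f x))"
    using H.subgroup_is_group[OF G.is_group] P.is_group by (simp add: group_hom_def group_hom_axioms_def)
  from group_hom.img_is_subgroup[OF this] have "subgroup \<Gamma> (G \<times>\<times> T)" by (simp add: \<Gamma>_def)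
  then have "\<Gamma> \<in> \<A>" using f.hom_one by (auto simp: \<A>_def \<Gamma>_def)
  moreover have "\<Union>\<C> \<in> \<A>" if "\<C> \<noteq> {}" "subset.chain \<A> \<C>" for \<C>
  proof -
    have "subset.chain {M. subgroup M (G \<times>\<times> T)} \<C>"
      using that(2) by (auto simp: subset_chain_def \<A>_def)
    then have "subgroup (\<Union>\<C>) (G \<times>\<times> T)" using that(1) by (intro subgroup_Union_chain) auto
    then show ?thesis using that by (auto simp: subset_chain_def \<A>_def)
  qed
  ultimately obtain M where "M \<in> \<A>" and max: "\<And>X. X \<in> \<A> \<Longrightarrow> M \<subseteq> X \<Longrightarrow> X = M"
    using subset_Zorn_nonempty[of \<A>] by (metis empty_iff)
  then have M: "subgroup M (G \<times>\<times> T)" "\<Gamma> \<subseteq> M" and single: "\<And>t. (\<one>\<^bsub>G\<^esub>, t) \<in> M \<Longrightarrow> t = \<one>\<^bsub>T\<^esub>"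
    by (auto simp: \<A>_def)
  have "y \<in> fst ` M" if y: "y \<in> carrier G" for y
  proof -
    obtain t where t: "t \<in> carrier T" "\<And>(k::int) u. (y [^]\<^bsub>G\<^esub> k, u) \<in> M \<Longrightarrow> t [^]\<^bsub>T\<^esub> k = u"
      using cyclic_graph_extension[OF G T M(1) single y] by blast
    define K where "K = generate (G \<times>\<times> T) {(y, t)}"
    have yt: "(y, t) \<in> carrier (G \<times>\<times> T)" using y t by simp
    have K: "subgroup K (G \<times>\<times> T)" unfolding K_def by (rule P.generate_is_subgroup) (use yt in simp)
    have K_eq: "K = range (\<lambda>k::int. (y [^]\<^bsub>G\<^esub> k, t [^]\<^bsub>T\<^esub> k))"
      unfolding K_def P.generate_pow[OF yt] using y t
      by (auto simp: DirProd_int_pow G.is_group T.is_group)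
    let ?N = "M <#>\<^bsub>G \<times>\<times> T\<^esub> K"
    have N: "subgroup ?N (G \<times>\<times> T)" using M(1) K by (rule P.mult_subgroups)
    have inN: "m \<otimes>\<^bsub>G \<times>\<times> T\<^esub> k \<in> ?N" if "m \<in> M" "k \<in> K" for m k
      using that by (auto simp: set_mult_def)
    have sub: "M \<subseteq> ?N"
    proof
      fix m assume "m \<in> M"
      then show "m \<in> ?N" using inN[of m "\<one>\<^bsub>G \<times>\<times> T\<^esub>"] subgroup.one_closed[OF K] subgroup.mem_carrier[OF M(1)]
        by (metis P.r_one)
    qed
    have "u = \<one>\<^bsub>T\<^esub>" if inN_u: "(\<one>\<^bsub>G\<^esub>, u) \<in> ?N" for u
    proof -
      obtain m j where mj: "m \<in> M" "j \<in> K" "(\<one>\<^bsub>G\<^esub>, u) = m \<otimes>\<^bsub>G \<times>\<times> T\<^esub> j"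
        using inN_u unfolding set_mult_def by blast
      obtain k :: int where "j = (y [^]\<^bsub>G\<^esub> k, t [^]\<^bsub>T\<^esub> k)" using mj(2) K_eq by blast
      then obtain x s where xs: "(x, s) \<in> M" "x \<otimes>\<^bsub>G\<^esub> y [^]\<^bsub>G\<^esub> k = \<one>\<^bsub>G\<^esub>" "u = s \<otimes>\<^bsub>T\<^esub> t [^]\<^bsub>T\<^esub> k"
        using mj by (cases m) auto
      have c: "x \<in> carrier G" "s \<in> carrier T" using subgroup.mem_carrier[OF M(1) xs(1)] by auto
      then have "x = inv\<^bsub>G\<^esub> (y [^]\<^bsub>G\<^esub> k)" using xs(2) y G.inv_equality[of x "y [^]\<^bsub>G\<^esub> k"] by simp
      then have "x = y [^]\<^bsub>G\<^esub> (- k)" using y by (simp add: G.int_pow_neg)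
      then have "t [^]\<^bsub>T\<^esub> (- k) = s" using xs(1) t(2) by blast
      then show ?thesis using xs(3) t(1) by (auto simp: T.int_pow_neg)
    qed
    then have "?N \<in> \<A>" using N sub M(2) by (auto simp: \<A>_def)
    then have "?N = M" using sub by (rule max)
    moreover have "(y, t) \<in> ?N"
      using inN[OF subgroup.one_closed[OF M(1)], of "(y, t)"] y t
      by (force simp: K_def intro: generate.incl)
    ultimately show ?thesis by force
  qed
  then have "fst ` M = carrier G" using subgroup.subset[OF M(1)] by force
  then obtain g where "g \<in> hom G T" "\<forall>(x, t) \<in> M. g x = t"
    using hom_of_graph[OF G.is_group T.is_group M(1) single] by auto
  then show ?thesis using M(2) by (intro bexI[of _ g]) (auto simp: \<Gamma>_def)
qed

section \<open>Split extensions\<close>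

locale comm_short_exact = A: comm_group A + B: comm_group B + C: comm_group C
  for A :: "'a monoid" and B :: "'b monoid" and C :: "'c monoid" +
  fixes \<phi> :: "'a \<Rightarrow> 'b" and \<psi> :: "'b \<Rightarrow> 'c"
  assumes exact: "short_exact A B C \<phi> \<psi>"
begin

lemma hom_phi: "\<phi> \<in> hom A B" and hom_psi: "\<psi> \<in> hom B C"
  and inj_phi: "inj_on \<phi> (carrier A)" and image_phi: "\<phi> ` carrier A = kernel B C \<psi>"
  and surj_psi: "\<psi> ` carrier B = carrier C"
  using exact by (auto simp: short_exact_def)

sublocale phi: group_hom A B \<phi>
  by unfold_locales (rule hom_phi)

sublocale psi: group_hom B C \<psi>
  by unfold_locales (rule hom_psi)

lemma psi_phi [simp]: "a \<in> carrier A \<Longrightarrow> \<psi> (\<phi> a) = \<one>\<^bsub>C\<^esub>"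
  using image_phi by (auto simp: kernel_def)

lemma kernel_psiE:
  assumes "b \<in> carrier B" "\<psi> b = \<one>\<^bsub>C\<^esub>"
  obtains a where "a \<in> carrier A" "b = \<phi> a"
  using assms image_phi by (auto simp: kernel_def)

lemma psi_eqE:
  assumes "b \<in> carrier B" "b' \<in> carrier B" "\<psi> b = \<psi> b'"
  obtains a where "a \<in> carrier A" "b = \<phi> a \<otimes>\<^bsub>B\<^esub> b'"
proof -
  have "\<psi> (b \<otimes>\<^bsub>B\<^esub> inv\<^bsub>B\<^esub> b') = \<one>\<^bsub>C\<^esub>" using assms by simp
  then obtain a where "a \<in> carrier A" "b \<otimes>\<^bsub>B\<^esub> inv\<^bsub>B\<^esub> b' = \<phi> a"
    using assms by (metis kernel_psiE B.m_closed B.inv_closed)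
  then show thesis using that assms by (metis B.inv_solve_right' phi.hom_closed B.inv_closed B.inv_inv)
qed

lemma psi_surjE:
  assumes "c \<in> carrier C"
  obtains b where "b \<in> carrier B" "\<psi> b = c"
proof -
  have "c \<in> \<psi> ` carrier B" using assms surj_psi by simp
  then show thesis using that by blast
qed

end

lemma extension_iff: "extension C A (B, \<phi>, \<psi>) \<longleftrightarrow> comm_short_exact A B C \<phi> \<psi>"
  by (auto simp: extension_def comm_short_exact_def comm_short_exact_axioms_def)

text \<open>
  Stated through a retraction rather than a section, because this form does not mention \<open>\<psi>\<close> and is
  the instance of the extension property for the identity of \<open>A\<close>.
\<close>

definition splits :: "'a monoid \<Rightarrow> ('a, 'b, 'c) extension \<Rightarrow> bool"
  where "splits A = (\<lambda>(B, \<phi>, \<psi>). \<exists>r \<in> hom B A. \<forall>a \<in> carrier A. r (\<phi> a) = a)"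

text \<open>
  The map \<open>b \<mapsto> b - \<phi> (r b)\<close> vanishes on the image of \<open>\<phi>\<close>, so it factors through \<open>\<psi>\<close>; the factor is a
  section.
\<close>

lemma splits_section:
  assumes "extension C A (B, \<phi>, \<psi>)" and "splits A (B, \<phi>, \<psi>)"
  shows "\<exists>s \<in> hom C B. \<forall>c \<in> carrier C. \<psi> (s c) = c"
proof -
  interpret comm_short_exact A B C \<phi> \<psi> using assms(1) by (simp add: extension_iff)
  obtain r where r: "r \<in> hom B A" "\<And>a. a \<in> carrier A \<Longrightarrow> r (\<phi> a) = a"
    using assms(2) by (auto simp: splits_def)
  interpret r: group_hom B A r by unfold_locales (rule r)
  let ?q = "\<lambda>b. b \<otimes>\<^bsub>B\<^esub> inv\<^bsub>B\<^esub> \<phi> (r b)"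
  have q: "?q \<in> hom B B" by (rule homI) (simp_all add: B.inv_mult B.m_ac)
  have "\<exists>s \<in> hom (C\<lparr>carrier := \<psi> ` carrier B\<rparr>) B. \<forall>b \<in> carrier B. s (\<psi> b) = ?q b"
  proof (rule hom_factor_through_image[OF _ _ _ hom_psi q])
    fix b assume "b \<in> carrier B" "\<psi> b = \<one>\<^bsub>C\<^esub>"
    then obtain a where "a \<in> carrier A" "b = \<phi> a" by (rule kernel_psiE)
    then show "?q b = \<one>\<^bsub>B\<^esub>" using r(2) by simp
  qed (simp_all add: B.is_group C.is_group)
  then obtain s where s: "s \<in> hom C B" "\<And>b. b \<in> carrier B \<Longrightarrow> s (\<psi> b) = ?q b"
    by (auto simp: surj_psi)
  have "\<psi> (s c) = c" if "c \<in> carrier C" for c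
  proof -
    obtain b where "b \<in> carrier B" "\<psi> b = c" using \<open>c \<in> carrier C\<close> by (rule psi_surjE)
    then show ?thesis using s(2)[of b] \<open>c \<in> carrier C\<close> by simp
  qed
  then show ?thesis using s(1) by blast
qed

lemma extension_split_ext:
  assumes "comm_group A" "comm_group C"
  shows "extension C A (split_ext C A)"
proof -
  interpret A: comm_group A by fact
  interpret C: comm_group C by fact
  have "short_exact A (A \<times>\<times> C) C (\<lambda>a. (a, \<one>\<^bsub>C\<^esub>)) snd"
    by (auto simp: short_exact_def hom_def mult_DirProd' kernel_def inj_on_def image_def)
  then show ?thesis
    using assms by (simp add: extension_def split_ext_def DirProd_comm_group)
qed

lemma ext_equiv_refl: "extension C A E \<Longrightarrow> ext_equiv A E E"
  by (cases E) (auto simp: ext_equiv_def intro!: bexI[OF _ iso_set_refl])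

lemma ext_equiv_sym:
  assumes "extension C A E" and "extension C A E'" and "ext_equiv A E E'"
  shows "ext_equiv A E' E"
proof -
  obtain B \<phi> \<psi> B' \<phi>' \<psi>' where E: "E = (B, \<phi>, \<psi>)" "E' = (B', \<phi>', \<psi>')" by (cases E, cases E')
  interpret E: comm_short_exact A B C \<phi> \<psi> using assms(1) E by (simp add: extension_iff)
  interpret E': comm_short_exact A B' C \<phi>' \<psi>' using assms(2) E by (simp add: extension_iff)
  obtain h where h: "h \<in> iso B B'" "\<And>a. a \<in> carrier A \<Longrightarrow> h (\<phi> a) = \<phi>' a"
    "\<And>b. b \<in> carrier B \<Longrightarrow> \<psi>' (h b) = \<psi> b"
    using assms(3) by (auto simp: ext_equiv_def E)
  let ?g = "inv_into (carrier B) h"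
  have bij: "bij_betw h (carrier B) (carrier B')" using h(1) by (simp add: iso_def)
  have "?g \<in> iso B' B" using h(1) by (rule E.B.iso_set_sym)
  moreover have "?g (\<phi>' a) = \<phi> a" if "a \<in> carrier A" for a
    using bij_betw_inv_into_left[OF bij, of "\<phi> a"] that h(2) by simp
  moreover have "\<psi> (?g b) = \<psi>' b" if "b \<in> carrier B'" for b
  proof -
    have "?g b \<in> carrier B" using bij that by (metis bij_betwE bij_betw_inv_into)
    then show ?thesis using h(3)[of "?g b"] bij_betw_inv_into_right[OF bij that] by simp
  qed
  ultimately show ?thesis by (auto simp: ext_equiv_def E)
qed

lemma ext_equiv_trans:
  assumes "extension C A E" and "ext_equiv A E E'" and "ext_equiv A E' E''"
  shows "ext_equiv A E E''"
proof -
  obtain B \<phi> \<psi> B' \<phi>' \<psi>' B'' \<phi>'' \<psi>''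
    where E: "E = (B, \<phi>, \<psi>)" "E' = (B', \<phi>', \<psi>')" "E'' = (B'', \<phi>'', \<psi>'')"
    by (cases E, cases E', cases E'')
  obtain h where h: "h \<in> iso B B'" "\<And>a. a \<in> carrier A \<Longrightarrow> h (\<phi> a) = \<phi>' a"
    "\<And>b. b \<in> carrier B \<Longrightarrow> \<psi>' (h b) = \<psi> b"
    using assms(2) by (auto simp: ext_equiv_def E)
  obtain k where k: "k \<in> iso B' B''" "\<And>a. a \<in> carrier A \<Longrightarrow> k (\<phi>' a) = \<phi>'' a"
    "\<And>b. b \<in> carrier B' \<Longrightarrow> \<psi>'' (k b) = \<psi>' b"
    using assms(3) by (auto simp: ext_equiv_def E)
  have "h b \<in> carrier B'" if "b \<in> carrier B" for b
    using h(1) that by (auto simp: iso_def hom_def)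
  then show ?thesis
    using h k by (auto simp: ext_equiv_def E intro!: bexI[of _ "k \<circ> h"] intro: iso_set_trans)
qed

lemma splits_of_ext_equiv:
  assumes "ext_equiv A E E'" and "splits A E'"
  shows "splits A E"
proof -
  obtain B \<phi> \<psi> B' \<phi>' \<psi>' where E: "E = (B, \<phi>, \<psi>)" "E' = (B', \<phi>', \<psi>')" by (cases E, cases E')
  obtain h where h: "h \<in> iso B B'" "\<And>a. a \<in> carrier A \<Longrightarrow> h (\<phi> a) = \<phi>' a"
    using assms(1) by (auto simp: ext_equiv_def E)
  obtain r where r: "r \<in> hom B' A" "\<And>a. a \<in> carrier A \<Longrightarrow> r (\<phi>' a) = a"
    using assms(2) by (auto simp: splits_def E)
  have "r \<circ> h \<in> hom B A" using h(1) r(1) by (auto simp: iso_def intro: hom_compose)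
  then show ?thesis using h(2) r(2) by (auto simp: splits_def E intro!: bexI[of _ "r \<circ> h"])
qed

text \<open>
  A retraction \<open>r\<close> yields the equivalence \<open>b \<mapsto> (r b, \<psi> b)\<close> with the direct sum; conversely the first
  projection is a retraction, and retractions are transported by equivalences.
\<close>

lemma splits_iff_equiv_split_ext:
  assumes "extension C A E"
  shows "splits A E \<longleftrightarrow> ext_equiv A E (split_ext C A)"
proof
  obtain B \<phi> \<psi> where E: "E = (B, \<phi>, \<psi>)" by (cases E)
  interpret comm_short_exact A B C \<phi> \<psi> using assms E by (simp add: extension_iff)
  assume "splits A E"
  then obtain r where r: "r \<in> hom B A" "\<And>a. a \<in> carrier A \<Longrightarrow> r (\<phi> a) = a"
    by (auto simp: splits_def E)
  interpret r: group_hom B A r by unfold_locales (rule r)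
  let ?h = "\<lambda>b. (r b, \<psi> b)"
  have hom: "?h \<in> hom B (A \<times>\<times> C)" by (auto simp: hom_def)
  interpret P: comm_group "A \<times>\<times> C"
    by (rule DirProd_comm_group) (simp_all add: A.comm_group_axioms C.comm_group_axioms)
  interpret h: group_hom B "A \<times>\<times> C" ?h by unfold_locales (rule hom)
  have "?h \<in> iso B (A \<times>\<times> C)"
    unfolding h.iso_iff
  proof
    show "carrier (A \<times>\<times> C) \<subseteq> ?h ` carrier B"
    proof
      fix x assume "x \<in> carrier (A \<times>\<times> C)"
      then obtain a c where ac: "x = (a, c)" "a \<in> carrier A" "c \<in> carrier C" by auto
      obtain b where b: "b \<in> carrier B" "\<psi> b = c" using ac(3) by (rule psi_surjE)
      let ?b = "b \<otimes>\<^bsub>B\<^esub> \<phi> (inv\<^bsub>A\<^esub> r b \<otimes>\<^bsub>A\<^esub> a)"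
      have "r ?b = a"
        using ac b by (simp add: r(2) A.m_assoc[symmetric])
      moreover have "\<psi> ?b = c" using ac b psi_phi by simp
      ultimately show "x \<in> ?h ` carrier B"
        using ac b by (intro image_eqI[of _ _ ?b]) auto
    qed
    show "\<forall>b\<in>carrier B. ?h b = \<one>\<^bsub>A \<times>\<times> C\<^esub> \<longrightarrow> b = \<one>\<^bsub>B\<^esub>"
      using r(2) by (auto elim!: kernel_psiE)
  qed
  then show "ext_equiv A E (split_ext C A)"
    using r(2) by (auto simp: ext_equiv_def E split_ext_def intro!: bexI[of _ ?h])
next
  assume equiv: "ext_equiv A E (split_ext C A)"
  have "splits A (split_ext C A)"
    unfolding splits_def split_ext_def prod.case
    by (rule bexI[of _ fst]) (auto simp: hom_def)
  with equiv show "splits A E" by (rule splits_of_ext_equiv)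
qed

lemma ext_class_eq_one_iff_splits:
  fixes E :: "('a, 'a \<times> 'c, 'c) extension"
  assumes E: "extension C A E"
  shows "ext_class C A E = \<one>\<^bsub>Ext C A\<^esub> \<longleftrightarrow> splits A E"
proof -
  obtain B \<phi> \<psi> where "E = (B, \<phi>, \<psi>)" by (cases E)
  then have split: "extension C A (split_ext C A)"
    using E by (intro extension_split_ext) (auto simp: extension_def)
  have one: "\<one>\<^bsub>Ext C A\<^esub> = ext_class C A (split_ext C A)" by (simp add: Ext_def)
  have "ext_class C A E = ext_class C A (split_ext C A) \<longleftrightarrow> ext_equiv A E (split_ext C A)"
  proof
    assume "ext_class C A E = ext_class C A (split_ext C A)"
    moreover have "E \<in> ext_class C A E" using E ext_equiv_refl[OF E] by (simp add: ext_class_def)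
    ultimately show "ext_equiv A E (split_ext C A)" by (simp add: ext_class_def)
  next
    assume "ext_equiv A E (split_ext C A)"
    then show "ext_class C A E = ext_class C A (split_ext C A)"
      using E split ext_equiv_sym ext_equiv_trans unfolding ext_class_def by blast
  qed
  then show ?thesis using one splits_iff_equiv_split_ext[OF E] by simp
qed

lemma Ext_trivial_iff:
  fixes A :: "'a monoid" and C :: "'c monoid"
  assumes "comm_group A" "comm_group C"
  shows "carrier (Ext C A) = {\<one>\<^bsub>Ext C A\<^esub>} \<longleftrightarrow>
    (\<forall>E :: ('a, 'a \<times> 'c, 'c) extension. extension C A E \<longrightarrow> splits A E)"
    (is "?L \<longleftrightarrow> ?R")
proof -
  have carrier: "carrier (Ext C A) =
      ext_class C A ` {E :: ('a, 'a \<times> 'c, 'c) extension. extension C A E}" by (simp add: Ext_def)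
  have "\<one>\<^bsub>Ext C A\<^esub> \<in> carrier (Ext C A)"
    using extension_split_ext[OF assms] by (simp add: Ext_def)
  then have "?L \<longleftrightarrow> carrier (Ext C A) \<subseteq> {\<one>\<^bsub>Ext C A\<^esub>}" by blast
  also have "\<dots> \<longleftrightarrow> (\<forall>E :: ('a, 'a \<times> 'c, 'c) extension. extension C A E \<longrightarrow> ext_class C A E = \<one>\<^bsub>Ext C A\<^esub>)"
    by (simp only: carrier image_subset_iff Ball_def mem_Collect_eq singleton_iff)
  also have "\<dots> \<longleftrightarrow> ?R" by (simp add: ext_class_eq_one_iff_splits cong: imp_cong)
  finally show ?thesis .
qed

section \<open>Torsion\<close>

lemma mem_torsion_part:
  "x \<in> carrier (torsion_part G) \<longleftrightarrow> x \<in> carrier G \<and> (\<exists>n::nat. n > 0 \<and> x [^]\<^bsub>G\<^esub> n = \<one>\<^bsub>G\<^esub>)"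
  by (simp add: torsion_part_def)

lemma torsion_part_simps [simp]:
  "monoid.mult (torsion_part G) = monoid.mult G" "one (torsion_part G) = one G"
  by (simp_all add: torsion_part_def)

lemma hom_torsion:
  assumes "group_hom G H h" and "x \<in> carrier (torsion_part G)"
  shows "h x \<in> carrier (torsion_part H)"
proof -
  interpret group_hom G H h by fact
  obtain n :: nat where "x \<in> carrier G" "n > 0" "x [^]\<^bsub>G\<^esub> n = \<one>\<^bsub>G\<^esub>"
    using assms(2) by (auto simp: mem_torsion_part)
  then show ?thesis using hom_nat_pow[of x n] by (auto simp: mem_torsion_part)
qed

lemma torsion_free_iff:
  assumes "group G"
  shows "torsion_free_group G \<longleftrightarrow>
    (\<forall>x \<in> carrier G. \<forall>n::nat. n > 0 \<longrightarrow> x [^]\<^bsub>G\<^esub> n = \<one>\<^bsub>G\<^esub> \<longrightarrow> x = \<one>\<^bsub>G\<^esub>)"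
proof -
  interpret group G by fact
  have "\<one>\<^bsub>G\<^esub> \<in> carrier (torsion_part G)" by (auto simp: mem_torsion_part intro!: exI[of _ 1])
  then have "torsion_free_group G \<longleftrightarrow> carrier (torsion_part G) \<subseteq> {\<one>\<^bsub>G\<^esub>}"
    unfolding torsion_free_group_def by blast
  then show ?thesis by (simp only: subset_iff mem_torsion_part singleton_iff) blast
qed

text \<open>
  Exactness at the left and in the middle is automatic, because a preimage under the injective
  map \<open>\<phi>\<close> of a torsion element is a torsion element.  Only surjectivity onto the torsion part of \<open>C\<close>
  is a condition.
\<close>

lemma t_extension_iff:
  "t_extension C A (B, \<phi>, \<psi>) \<longleftrightarrow>
    extension C A (B, \<phi>, \<psi>) \<and> carrier (torsion_part C) \<subseteq> \<psi> ` carrier (torsion_part B)"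
proof (cases "extension C A (B, \<phi>, \<psi>)")
  case True
  then interpret comm_short_exact A B C \<phi> \<psi> by (simp add: extension_iff)
  have "short_exact (torsion_part A) (torsion_part B) (torsion_part C) \<phi> \<psi>"
    if sub: "carrier (torsion_part C) \<subseteq> \<psi> ` carrier (torsion_part B)"
    unfolding short_exact_def
  proof (intro conjI)
    show "\<phi> \<in> hom (torsion_part A) (torsion_part B)"
      using hom_torsion[OF phi.group_hom_axioms] by (auto simp: hom_def mem_torsion_part[of _ A])
    show "\<psi> \<in> hom (torsion_part B) (torsion_part C)"
      using hom_torsion[OF psi.group_hom_axioms] by (auto simp: hom_def mem_torsion_part[of _ B])
    show "inj_on \<phi> (carrier (torsion_part A))"
      using inj_phi by (rule inj_on_subset) (auto simp: mem_torsion_part)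
    show "\<psi> ` carrier (torsion_part B) = carrier (torsion_part C)"
      using sub hom_torsion[OF psi.group_hom_axioms] by blast
    show "\<phi> ` carrier (torsion_part A) = kernel (torsion_part B) (torsion_part C) \<psi>"
    proof (intro equalityI subsetI)
      fix x assume "x \<in> \<phi> ` carrier (torsion_part A)"
      then show "x \<in> kernel (torsion_part B) (torsion_part C) \<psi>"
        using hom_torsion[OF phi.group_hom_axioms] by (auto simp: kernel_def mem_torsion_part[of _ A])
    next
      fix b assume "b \<in> kernel (torsion_part B) (torsion_part C) \<psi>"
      then obtain n :: nat where b: "b \<in> carrier B" "\<psi> b = \<one>\<^bsub>C\<^esub>" "n > 0" "b [^]\<^bsub>B\<^esub> n = \<one>\<^bsub>B\<^esub>"
        by (auto simp: kernel_def mem_torsion_part)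
      obtain a where a: "a \<in> carrier A" "b = \<phi> a" using b(1,2) by (rule kernel_psiE)
      then have "\<phi> (a [^]\<^bsub>A\<^esub> n) = \<phi> \<one>\<^bsub>A\<^esub>" using b(4) by (simp add: phi.hom_nat_pow)
      then have "a [^]\<^bsub>A\<^esub> n = \<one>\<^bsub>A\<^esub>" using inj_onD[OF inj_phi, of "a [^]\<^bsub>A\<^esub> n" "\<one>\<^bsub>A\<^esub>"] a by simp
      then show "b \<in> \<phi> ` carrier (torsion_part A)" using a b(3) by (intro image_eqI[of _ _ a]) (auto simp: mem_torsion_part)
    qed
  qed
  then show ?thesis using True by (auto simp: t_extension_def short_exact_def)
qed (simp add: t_extension_def)

lemma extension_of_t_extension: "t_extension C A E \<Longrightarrow> extension C A E"
  by (cases E) (simp add: t_extension_def)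

text \<open>
  A class belongs to \<open>Ext_t C A\<close> if one of its members is a t-extension.  All members of a class
  split together, so it does not matter which one.
\<close>

lemma Ext_t_trivial_iff:
  fixes A :: "'a monoid" and C :: "'c monoid"
  assumes "comm_group A" "comm_group C"
  shows "carrier (Ext_t C A) = {\<one>\<^bsub>Ext_t C A\<^esub>} \<longleftrightarrow>
    (\<forall>E :: ('a, 'a \<times> 'c, 'c) extension. t_extension C A E \<longrightarrow> splits A E)"
    (is "?L \<longleftrightarrow> ?R")
proof -
  have ext: "extension C A E" if "t_extension C A E" for E :: "('a, 'a \<times> 'c, 'c) extension"
    using that by (rule extension_of_t_extension)
  have one: "\<one>\<^bsub>Ext_t C A\<^esub> = \<one>\<^bsub>Ext C A\<^esub>" by (simp add: Ext_t_def)
  have memI: "ext_class C A E \<in> carrier (Ext_t C A)"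
    if "extension C A E" "t_extension C A E'" "ext_equiv A E' E"
    for E E' :: "('a, 'a \<times> 'c, 'c) extension"
  proof -
    have "E' \<in> ext_class C A E" using that ext by (simp add: ext_class_def)
    then show ?thesis using that by (simp add: Ext_t_def Ext_def) blast
  qed
  have memE: "\<exists>(E :: ('a, 'a \<times> 'c, 'c) extension) (E' :: ('a, 'a \<times> 'c, 'c) extension).
      X = ext_class C A E \<and> extension C A E \<and> t_extension C A E' \<and> ext_equiv A E' E"
    if X: "X \<in> carrier (Ext_t C A)" for X
  proof -
    from X have "X \<in> ext_class C A ` {E :: ('a, 'a \<times> 'c, 'c) extension. extension C A E}"
      "\<exists>E' \<in> X. t_extension C A E'"
      by (simp_all add: Ext_t_def Ext_def)
    then obtain E E' :: "('a, 'a \<times> 'c, 'c) extension"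
      where "extension C A E" "X = ext_class C A E" "E' \<in> X" "t_extension C A E'"
      by blast
    then show ?thesis by (intro exI[of _ E] exI[of _ E']) (simp add: ext_class_def)
  qed
  have split: "extension C A (split_ext C A)" using assms by (rule extension_split_ext)
  have "group A" using assms(1) by (rule comm_group.axioms(2))
  then have one_pow: "\<one>\<^bsub>A\<^esub> [^]\<^bsub>A\<^esub> (n::nat) = \<one>\<^bsub>A\<^esub>" "\<one>\<^bsub>A\<^esub> \<in> carrier A" for n
    by (simp_all add: group.is_monoid monoid.nat_pow_one)
  have "c \<in> snd ` carrier (torsion_part (A \<times>\<times> C))" if "c \<in> carrier (torsion_part C)" for c
    using that one_pow by (intro image_eqI[of _ _ "(\<one>\<^bsub>A\<^esub>, c)"]) (auto simp: mem_torsion_part)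
  then have tsplit: "t_extension C A (split_ext C A)"
    using split by (auto simp: split_ext_def t_extension_iff)
  show ?thesis
  proof
    assume L: ?L
    show ?R
    proof (intro allI impI)
      fix E :: "('a, 'a \<times> 'c, 'c) extension" assume E: "t_extension C A E"
      then have "ext_class C A E \<in> carrier (Ext_t C A)"
        using memI[OF ext E] ext_equiv_refl[OF ext] by blast
      then have "ext_class C A E = \<one>\<^bsub>Ext C A\<^esub>" using L one by auto
      then show "splits A E" using ext_class_eq_one_iff_splits[OF ext[OF E]] by simp
    qed
  next
    assume R: ?R
    have "X = \<one>\<^bsub>Ext C A\<^esub>" if "X \<in> carrier (Ext_t C A)" for X
    proof -
      obtain E E' :: "('a, 'a \<times> 'c, 'c) extension" where E: "X = ext_class C A E" "extension C A E" "t_extension C A E'" "ext_equiv A E' E"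
        using memE \<open>X \<in> carrier (Ext_t C A)\<close> by metis
      have "ext_equiv A E E'" using ext[OF E(3)] E(2,4) by (rule ext_equiv_sym)
      then have "splits A E" by (rule splits_of_ext_equiv) (use R E(3) in blast)
      then show ?thesis using E ext_class_eq_one_iff_splits by blast
    qed
    moreover have "\<one>\<^bsub>Ext C A\<^esub> \<in> carrier (Ext_t C A)"
      using memI[OF split tsplit ext_equiv_refl[OF split]] by (simp add: Ext_def)
    ultimately show ?L unfolding one by blast
  qed
qed

lemma t_extension_of_ext_equiv:
  assumes "ext_equiv A E' E" and "extension C A E'" and "t_extension C A E"
  shows "t_extension C A E'"
proof -
  obtain B \<phi> \<psi> B' \<phi>' \<psi>' where E: "E = (B, \<phi>, \<psi>)" "E' = (B', \<phi>', \<psi>')" by (cases E, cases E')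
  have "ext_equiv A E E'"
    using assms(2) extension_of_t_extension[OF assms(3)] assms(1) by (rule ext_equiv_sym)
  then obtain h where h: "h \<in> iso B B'" "\<And>b. b \<in> carrier B \<Longrightarrow> \<psi>' (h b) = \<psi> b"
    by (auto simp: ext_equiv_def E)
  have t: "extension C A (B, \<phi>, \<psi>)" "carrier (torsion_part C) \<subseteq> \<psi> ` carrier (torsion_part B)"
    using assms(3) by (simp_all add: E t_extension_iff)
  interpret E: comm_short_exact A B C \<phi> \<psi> using t by (simp add: extension_iff)
  interpret E': comm_short_exact A B' C \<phi>' \<psi>' using assms(2) E by (simp add: extension_iff)
  interpret h: group_hom B B' h by unfold_locales (use h(1) in \<open>simp add: iso_def\<close>)
  have "\<psi> b \<in> \<psi>' ` carrier (torsion_part B')" if "b \<in> carrier (torsion_part B)" for b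
    using hom_torsion[OF h.group_hom_axioms that] h(2)[of b] that
    by (intro image_eqI[of _ _ "h b"]) (simp_all add: mem_torsion_part[of b])
  then show ?thesis using assms(2) t by (auto simp: E t_extension_iff)
qed

section \<open>Lifting along extensions of cotorsion groups\<close>

definition pullback ::
    "'d monoid \<Rightarrow> 'b monoid \<Rightarrow> ('d \<Rightarrow> 'c) \<Rightarrow> ('b \<Rightarrow> 'c) \<Rightarrow> ('d \<times> 'b) monoid"
  where "pullback C' B \<mu> \<psi> =
    (C' \<times>\<times> B)\<lparr>carrier := {(c, b). c \<in> carrier C' \<and> b \<in> carrier B \<and> \<psi> b = \<mu> c}\<rparr>"

text \<open>
  The functoriality of \<open>Ext\<close> in its first argument.
\<close>

lemma extension_pullback:
  assumes "extension C A (B, \<phi>, \<psi>)" and "comm_group C'" and "\<mu> \<in> hom C' C"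
  shows "extension C' A (pullback C' B \<mu> \<psi>, \<lambda>a. (\<one>\<^bsub>C'\<^esub>, \<phi> a), fst)"
proof -
  interpret comm_short_exact A B C \<phi> \<psi> using assms(1) by (simp add: extension_iff)
  interpret C': comm_group C' by fact
  interpret mu: group_hom C' C \<mu> by unfold_locales (rule assms(3))
  interpret P: comm_group "C' \<times>\<times> B"
    using assms(2) B.comm_group_axioms by (rule DirProd_comm_group)
  let ?S = "{(c, b). c \<in> carrier C' \<and> b \<in> carrier B \<and> \<psi> b = \<mu> c}"
  have "subgroup ?S (C' \<times>\<times> B)"
  proof (rule P.subgroupI)
    have "(\<one>\<^bsub>C'\<^esub>, \<one>\<^bsub>B\<^esub>) \<in> ?S" by simp
    then show "?S \<noteq> {}" by blast
  qed auto
  then have "comm_group (pullback C' B \<mu> \<psi>)"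
    unfolding pullback_def by (rule subgroup_imp_comm_group[OF P.comm_group_axioms])
  moreover have "short_exact A (pullback C' B \<mu> \<psi>) C' (\<lambda>a. (\<one>\<^bsub>C'\<^esub>, \<phi> a)) fst"
    unfolding short_exact_def
  proof (intro conjI)
    show "(\<lambda>a. (\<one>\<^bsub>C'\<^esub>, \<phi> a)) \<in> hom A (pullback C' B \<mu> \<psi>)"
      by (auto simp: hom_def pullback_def)
    show "fst \<in> hom (pullback C' B \<mu> \<psi>) C'" by (auto simp: hom_def pullback_def)
    show "inj_on (\<lambda>a. (\<one>\<^bsub>C'\<^esub>, \<phi> a)) (carrier A)" using inj_phi by (auto simp: inj_on_def)
    show "(\<lambda>a. (\<one>\<^bsub>C'\<^esub>, \<phi> a)) ` carrier A = kernel (pullback C' B \<mu> \<psi>) C' fst"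
      by (auto simp: kernel_def pullback_def elim!: kernel_psiE)
    show "fst ` carrier (pullback C' B \<mu> \<psi>) = carrier C'"
    proof (intro equalityI subsetI)
      fix c assume c: "c \<in> carrier C'"
      then have "\<mu> c \<in> carrier C" by simp
      then obtain b where "b \<in> carrier B" "\<psi> b = \<mu> c" by (rule psi_surjE)
      then show "c \<in> fst ` carrier (pullback C' B \<mu> \<psi>)"
        using c by (intro image_eqI[of _ _ "(c, b)"]) (auto simp: pullback_def)
    qed (auto simp: pullback_def)
  qed
  ultimately show ?thesis
    using A.comm_group_axioms assms(2) by (simp add: extension_def)
qed

text \<open>
  A section of the pullback along \<open>\<mu>\<close>, followed by the projection to \<open>B\<close>, is a lift of \<open>\<mu>\<close>.
\<close>

lemma lift_of_pullback_splits:
  assumes "extension C A (B, \<phi>, \<psi>)" and "comm_group C'" and "\<mu> \<in> hom C' C"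
    and "splits A (pullback C' B \<mu> \<psi>, \<lambda>a. (\<one>\<^bsub>C'\<^esub>, \<phi> a), fst :: _ \<Rightarrow> 'd)"
  shows "\<exists>l \<in> hom C' B. \<forall>c \<in> carrier C'. \<psi> (l c) = \<mu> c"
proof -
  obtain s where s: "s \<in> hom C' (pullback C' B \<mu> \<psi>)" "\<And>c. c \<in> carrier C' \<Longrightarrow> fst (s c) = c"
    using splits_section[OF extension_pullback[OF assms(1-3)] assms(4)] by blast
  have "s c \<in> carrier (pullback C' B \<mu> \<psi>)" if "c \<in> carrier C'" for c
    using s(1) that by (rule hom_in_carrier)
  then have "\<psi> (snd (s c)) = \<mu> c" if "c \<in> carrier C'" for c
    using s(2)[OF that] that by (fastforce simp: pullback_def)
  moreover have "snd \<in> hom (pullback C' B \<mu> \<psi>) B" by (auto simp: hom_def pullback_def)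
  then have "snd \<circ> s \<in> hom C' B" using s(1) by (rule hom_compose[rotated])
  ultimately show ?thesis by (intro bexI[of _ "snd \<circ> s"]) auto
qed

lemma rat_group_simps [simp]:
  "carrier rat_group = UNIV" "monoid.mult rat_group = (+)" "one rat_group = 0"
  by (simp_all add: rat_group_def)

lemma comm_group_rat_group: "comm_group rat_group"
proof (rule comm_groupI)
  show "\<exists>y \<in> carrier rat_group. y \<otimes>\<^bsub>rat_group\<^esub> x = \<one>\<^bsub>rat_group\<^esub>" for x
    by (rule bexI[of _ "- x"]) simp_all
qed simp_all

lemma rat_group_nat_pow [simp]: "q [^]\<^bsub>rat_group\<^esub> (n::nat) = of_nat n * q"
  by (induction n) (simp_all add: algebra_simps)

lemma rat_group_inv [simp]: "inv\<^bsub>rat_group\<^esub> q = - q"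
proof -
  interpret comm_group rat_group by (rule comm_group_rat_group)
  show ?thesis by (rule inv_equality) simp_all
qed

lemma rat_group_int_pow [simp]: "q [^]\<^bsub>rat_group\<^esub> (n::int) = of_int n * q"
  by (simp add: int_pow_def2)

lemma torsion_free_rat_group: "torsion_free_group rat_group"
  using comm_group_rat_group by (simp add: torsion_free_iff comm_group.axioms(2))

lemma cotorsion_group_iff:
  fixes A :: "'a monoid"
  assumes "comm_group A"
  shows "cotorsion_group A \<longleftrightarrow>
    (\<forall>E :: ('a, 'a \<times> rat, rat) extension. extension rat_group A E \<longrightarrow> splits A E)"
  unfolding cotorsion_group_def by (rule Ext_trivial_iff[OF assms comm_group_rat_group])

text \<open>
  Cotorsion speaks only about extensions whose middle group has a fixed element type; every
  other extension of the rationals is equivalent to one of these.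
\<close>

lemma cotorsion_group_splits:
  fixes A :: "'a monoid" and E :: "('a, 'b, rat) extension"
  assumes "cotorsion_group A" and E: "extension rat_group A E"
  shows "splits A E"
proof -
  obtain E' where "E' \<in> ext_class rat_group A E" using ext_class_nonempty[OF E] by blast
  then have E': "extension rat_group A E'" "ext_equiv A E' E" by (auto simp: ext_class_def)
  have "comm_group A" using E by (cases E) (simp add: extension_def)
  then have "splits A E'" using assms(1) E'(1) by (simp only: cotorsion_group_iff)
  with ext_equiv_sym[OF E'(1) E E'(2)] show ?thesis by (rule splits_of_ext_equiv)
qed

lemma cotorsion_lift_rat:
  assumes "cotorsion_group A" and E: "extension C A (B, \<phi>, \<psi>)" and "\<mu> \<in> hom rat_group C"
  shows "\<exists>l \<in> hom rat_group B. \<forall>q. \<psi> (l q) = \<mu> q"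
proof -
  have "splits A (pullback rat_group B \<mu> \<psi>, \<lambda>a. (\<one>\<^bsub>rat_group\<^esub>, \<phi> a), fst :: rat \<times> _ \<Rightarrow> rat)"
    by (rule cotorsion_group_splits[OF assms(1) extension_pullback[OF E comm_group_rat_group assms(3)]])
  from lift_of_pullback_splits[OF E comm_group_rat_group assms(3) this] show ?thesis by simp
qed

lemma rat_hom_through_point:
  assumes W: "comm_group W" "divisible_group W" and y: "y \<in> carrier W"
  shows "\<exists>\<nu> \<in> hom rat_group W. \<nu> 1 = y"
proof -
  interpret Q: comm_group rat_group by (rule comm_group_rat_group)
  interpret W: comm_group W by fact
  have H: "subgroup \<int> rat_group" by (rule Q.subgroupI) auto
  have "(\<lambda>q. y [^]\<^bsub>W\<^esub> \<lfloor>q\<rfloor>) \<in> hom (rat_group\<lparr>carrier := \<int>\<rparr>) W"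
  proof (rule homI)
    fix p q assume "p \<in> carrier (rat_group\<lparr>carrier := \<int>\<rparr>)" "q \<in> carrier (rat_group\<lparr>carrier := \<int>\<rparr>)"
    then obtain i j where "p = of_int i" "q = of_int j" by (auto elim!: Ints_cases)
    then have "\<lfloor>p + q\<rfloor> = \<lfloor>p\<rfloor> + \<lfloor>q\<rfloor>" by simp
    then show "y [^]\<^bsub>W\<^esub> \<lfloor>p \<otimes>\<^bsub>rat_group\<lparr>carrier := \<int>\<rparr>\<^esub> q\<rfloor> = y [^]\<^bsub>W\<^esub> \<lfloor>p\<rfloor> \<otimes>\<^bsub>W\<^esub> y [^]\<^bsub>W\<^esub> \<lfloor>q\<rfloor>"
      using y by (simp add: W.int_pow_mult)
  qed (use y in simp)
  from divisible_group_injective[OF comm_group_rat_group W H this]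
  obtain \<nu> where \<nu>: "\<nu> \<in> hom rat_group W" "\<And>q. q \<in> \<int> \<Longrightarrow> \<nu> q = y [^]\<^bsub>W\<^esub> \<lfloor>q\<rfloor>"
    by auto
  have "\<nu> 1 = y" using \<nu>(2)[of 1] y by simp
  then show ?thesis using \<nu>(1) by blast
qed

text \<open>
  A divisible torsion-free \<open>W\<close> is a rational vector space, and its lines are images of the rational
  numbers, on which \<open>\<mu>\<close> can be lifted.  A maximal lift on a divisible subgroup is
  defined everywhere: the line through a point outside such a subgroup meets it only in the neutral
  element, so a lift on the line can be added to it without any compatibility condition.
\<close>

theorem cotorsion_lift_divisible:
  assumes D: "cotorsion_group D" and E: "extension C D (B, \<phi>, \<psi>)"
    and W: "comm_group W" "divisible_group W" "torsion_free_group W" and \<mu>: "\<mu> \<in> hom W C"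
  shows "\<exists>l \<in> hom W B. \<forall>w \<in> carrier W. \<psi> (l w) = \<mu> w"
proof -
  interpret comm_short_exact D B C \<phi> \<psi> using E by (simp add: extension_iff)
  interpret Q: comm_group rat_group by (rule comm_group_rat_group)
  interpret W: comm_group W by fact
  interpret mu: group_hom W C \<mu> by unfold_locales (rule \<mu>)
  interpret P: comm_group "W \<times>\<times> B" using W(1) B.comm_group_axioms by (rule DirProd_comm_group)
  interpret pr: group_hom "W \<times>\<times> B" W fst by unfold_locales (auto simp: hom_def)
  have tf: "w = \<one>\<^bsub>W\<^esub>" if "w \<in> carrier W" "n > 0" "w [^]\<^bsub>W\<^esub> n = \<one>\<^bsub>W\<^esub>" for w and n :: nat
    using W(3) that torsion_free_iff[OF W.is_group] by blast
  \<comment> \<open>Graphs of partial lifts whose domain is divisible, that is, a rational subspace.\<close>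
  define \<A> where "\<A> = {M. subgroup M (W \<times>\<times> B) \<and> (\<forall>(w, b) \<in> M. \<psi> b = \<mu> w) \<and>
    (\<forall>b. (\<one>\<^bsub>W\<^esub>, b) \<in> M \<longrightarrow> b = \<one>\<^bsub>B\<^esub>) \<and>
    (\<forall>w \<in> fst ` M. \<forall>n::nat. n > 0 \<longrightarrow> (\<exists>v \<in> fst ` M. v [^]\<^bsub>W\<^esub> n = w))}"
  have "{\<one>\<^bsub>W \<times>\<times> B\<^esub>} \<in> \<A>"
    using P.triv_subgroup by (simp add: \<A>_def)
  moreover have "\<Union>\<C> \<in> \<A>" if "\<C> \<noteq> {}" and chain: "subset.chain \<A> \<C>" for \<C>
  proof -
    have mem: "H \<in> \<A>" if "H \<in> \<C>" for H using chain that by (auto simp: subset_chain_def)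
    have "subset.chain {M. subgroup M (W \<times>\<times> B)} \<C>"
      using chain by (auto simp: subset_chain_def \<A>_def)
    then have "subgroup (\<Union>\<C>) (W \<times>\<times> B)" using P.is_group \<open>\<C> \<noteq> {}\<close> by (intro subgroup_Union_chain) auto
    moreover have "\<exists>v \<in> fst ` \<Union>\<C>. v [^]\<^bsub>W\<^esub> n = w" if w: "w \<in> fst ` \<Union>\<C>" "n > 0" for w and n :: nat
    proof -
      obtain H where H: "H \<in> \<C>" "w \<in> fst ` H" using w by auto
      then obtain v where "v \<in> fst ` H" "v [^]\<^bsub>W\<^esub> n = w"
        using mem[OF H(1)] w(2) unfolding \<A>_def by blast
      then show ?thesis using H(1) by (intro bexI[of _ v]) auto
    qed
    moreover have "\<psi> b = \<mu> w" if wb: "(w, b) \<in> \<Union>\<C>" for w b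
    proof -
      obtain H where "H \<in> \<C>" "(w, b) \<in> H" using wb by blast
      then show ?thesis using mem[of H] by (auto simp: \<A>_def)
    qed
    moreover have "b = \<one>\<^bsub>B\<^esub>" if "(\<one>\<^bsub>W\<^esub>, b) \<in> \<Union>\<C>" for b
      using that mem by (auto simp: \<A>_def)
    ultimately show ?thesis unfolding \<A>_def by (intro CollectI conjI) (blast, blast, blast, meson)
  qed
  ultimately obtain M where "M \<in> \<A>" and max: "\<And>X. X \<in> \<A> \<Longrightarrow> M \<subseteq> X \<Longrightarrow> X = M"
    using subset_Zorn_nonempty[of \<A>] by (metis empty_iff)
  then have M: "subgroup M (W \<times>\<times> B)" and lift: "\<And>w b. (w, b) \<in> M \<Longrightarrow> \<psi> b = \<mu> w"
    and single: "\<And>b. (\<one>\<^bsub>W\<^esub>, b) \<in> M \<Longrightarrow> b = \<one>\<^bsub>B\<^esub>"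
    and div: "\<And>w n. w \<in> fst ` M \<Longrightarrow> (n::nat) > 0 \<Longrightarrow> \<exists>v \<in> fst ` M. v [^]\<^bsub>W\<^esub> n = w"
    by (auto simp: \<A>_def)
  have F: "subgroup (fst ` M) W" using M by (rule pr.subgroup_img_is_subgroup)
  have "y \<in> fst ` M" if y: "y \<in> carrier W" for y
  proof (rule ccontr)
    assume y_notin: "y \<notin> fst ` M"
    obtain \<nu> where \<nu>: "\<nu> \<in> hom rat_group W" "\<nu> 1 = y"
      using rat_hom_through_point[OF W(1,2) y] by blast
    interpret nu: group_hom rat_group W \<nu> by unfold_locales (rule \<nu>)
    have "\<mu> \<circ> \<nu> \<in> hom rat_group C" using \<nu>(1) \<mu> by (rule hom_compose)
    from cotorsion_lift_rat[OF D E this]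
    obtain l where l: "l \<in> hom rat_group B" "\<And>q. \<psi> (l q) = \<mu> (\<nu> q)" by auto
    interpret l: group_hom rat_group B l by unfold_locales (rule l)
    \<comment> \<open>The line through \<open>y\<close> meets the domain only in the neutral element.\<close>
    have zero: "q = 0" if q: "\<nu> q \<in> fst ` M" for q
    proof (rule ccontr)
      assume "q \<noteq> 0"
      obtain j m where jm: "quotient_of (1 / q) = (j, m)" by (cases "quotient_of (1 / q)")
      then have m: "m > 0" "1 / q = of_int j / of_int m"
        using quotient_of_denom_pos quotient_of_div by blast+
      then have "of_nat (nat m) * 1 = of_int j * q" using \<open>q \<noteq> 0\<close> by (simp add: field_simps)
      then have "\<nu> (1 [^]\<^bsub>rat_group\<^esub> nat m) = \<nu> (q [^]\<^bsub>rat_group\<^esub> j)" by simp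
      then have pow: "y [^]\<^bsub>W\<^esub> nat m = \<nu> q [^]\<^bsub>W\<^esub> j"
        using \<nu>(2) nu.hom_nat_pow[of 1 "nat m"] nu.hom_int_pow[of q j] by simp
      have "\<nu> q [^]\<^bsub>W\<^esub> j \<in> fst ` M" using W.subgroup_int_pow_closed[OF F q] .
      then obtain v where v: "v \<in> fst ` M" "v [^]\<^bsub>W\<^esub> nat m = y [^]\<^bsub>W\<^esub> nat m"
        using div[of _ "nat m"] m(1) pow by auto
      have vW: "v \<in> carrier W" using subgroup.mem_carrier[OF F v(1)] .
      then have "(y \<otimes>\<^bsub>W\<^esub> inv\<^bsub>W\<^esub> v) [^]\<^bsub>W\<^esub> nat m = \<one>\<^bsub>W\<^esub>"
        using y v(2) by (simp add: W.nat_pow_distrib W.nat_pow_inv)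
      then have "y \<otimes>\<^bsub>W\<^esub> inv\<^bsub>W\<^esub> v = \<one>\<^bsub>W\<^esub>" using tf[of _ "nat m"] y vW m(1) by simp
      then have "y = v" using y vW by (metis W.inv_closed W.inv_equality W.inv_inv)
      then show False using v(1) y_notin by simp
    qed
    define K where "K = range (\<lambda>q. (\<nu> q, l q))"
    have "group_hom rat_group (W \<times>\<times> B) (\<lambda>q. (\<nu> q, l q))"
      using nu.hom_mult l.hom_mult nu.hom_closed l.hom_closed
      by unfold_locales (simp add: hom_def)
    from group_hom.img_is_subgroup[OF this] have K: "subgroup K (W \<times>\<times> B)" by (simp add: K_def)
    let ?N = "M <#>\<^bsub>W \<times>\<times> B\<^esub> K"
    have N: "subgroup ?N (W \<times>\<times> B)" using M K by (rule P.mult_subgroups)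
    have inN: "m \<otimes>\<^bsub>W \<times>\<times> B\<^esub> (\<nu> q, l q) \<in> ?N" if "m \<in> M" for m q
      using that by (auto simp: set_mult_def K_def)
    have N_elim: "\<exists>w b q. (w, b) \<in> M \<and> x = (w \<otimes>\<^bsub>W\<^esub> \<nu> q, b \<otimes>\<^bsub>B\<^esub> l q) \<and>
        w \<in> carrier W \<and> b \<in> carrier B" if x: "x \<in> ?N" for x
    proof -
      obtain m q where m: "m \<in> M" "x = m \<otimes>\<^bsub>W \<times>\<times> B\<^esub> (\<nu> q, l q)"
        using x unfolding set_mult_def K_def by blast
      then show ?thesis using subgroup.mem_carrier[OF M m(1)] by (cases m) auto
    qed
    have sub: "M \<subseteq> ?N"
    proof
      fix m assume "m \<in> M"
      then show "m \<in> ?N" using inN[of m 0] subgroup.mem_carrier[OF M, of m] nu.hom_one l.hom_one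
        by (cases m) auto
    qed
    have "?N \<in> \<A>"
      unfolding \<A>_def
    proof (intro CollectI conjI allI impI ballI N, safe)
      fix w b assume "(w, b) \<in> ?N"
      then obtain w' b' q where "(w', b') \<in> M" "w = w' \<otimes>\<^bsub>W\<^esub> \<nu> q" "b = b' \<otimes>\<^bsub>B\<^esub> l q"
        "w' \<in> carrier W" "b' \<in> carrier B"
        using N_elim by blast
      then show "\<psi> b = \<mu> w" using lift[of w' b'] l(2) nu.hom_closed l.hom_closed by simp
    next
      fix b assume "(\<one>\<^bsub>W\<^esub>, b) \<in> ?N"
      then obtain w' b' q where w': "(w', b') \<in> M" "\<one>\<^bsub>W\<^esub> = w' \<otimes>\<^bsub>W\<^esub> \<nu> q" "b = b' \<otimes>\<^bsub>B\<^esub> l q"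
        "w' \<in> carrier W" "b' \<in> carrier B"
        using N_elim by blast
      have "\<nu> q = inv\<^bsub>W\<^esub> w'"
        using w' nu.hom_closed[of q] W.inv_equality[of "\<nu> q" w'] W.m_comm[of w' "\<nu> q"] by simp
      moreover have "w' \<in> fst ` M" using w'(1) by force
      ultimately have "\<nu> q \<in> fst ` M" using subgroup.m_inv_closed[OF F] by simp
      then have "q = 0" by (rule zero)
      then have "\<nu> q = \<one>\<^bsub>W\<^esub>" "l q = \<one>\<^bsub>B\<^esub>" using nu.hom_one l.hom_one by simp_all
      then have "w' = \<one>\<^bsub>W\<^esub>" "b = b'"
        using w'(2) W.r_one[OF w'(4)] w'(3) B.r_one[OF w'(5)] by metis+
      then show "b = \<one>\<^bsub>B\<^esub>" using w'(1) single[of b'] by simp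
    next
      fix w b and n :: nat assume wb: "(w, b) \<in> ?N" and n: "n > 0"
      then obtain w' b' q where w': "(w', b') \<in> M" "w = w' \<otimes>\<^bsub>W\<^esub> \<nu> q" "w' \<in> carrier W"
        using N_elim by blast
      then have "w' \<in> fst ` M" by force
      then obtain v c where v: "(v, c) \<in> M" "v [^]\<^bsub>W\<^esub> n = w'" using div[OF _ n] by fastforce
      have vc: "v \<in> carrier W" "c \<in> carrier B" using subgroup.mem_carrier[OF M v(1)] by auto
      have "\<nu> (q / of_nat n) [^]\<^bsub>W\<^esub> n = \<nu> q"
        using nu.hom_nat_pow[of "q / of_nat n" n] n by simp
      then have "(v \<otimes>\<^bsub>W\<^esub> \<nu> (q / of_nat n)) [^]\<^bsub>W\<^esub> n = w"
        using w' v vc nu.hom_closed by (simp add: W.nat_pow_distrib)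
      moreover have "v \<otimes>\<^bsub>W\<^esub> \<nu> (q / of_nat n) \<in> fst ` ?N"
        using inN[OF v(1), of "q / of_nat n"] by force
      ultimately show "\<exists>v \<in> fst ` ?N. v [^]\<^bsub>W\<^esub> n = fst (w, b)"
        by (metis fst_conv)
    qed
    then have "?N = M" using sub by (rule max)
    moreover have "(y, l 1) \<in> ?N"
      using inN[OF subgroup.one_closed[OF M], of 1] \<nu>(2) y l.hom_closed[of 1] by simp
    ultimately show False using y_notin by force
  qed
  then have "fst ` M = carrier W" using subgroup.subset[OF M] by force
  then obtain l where "l \<in> hom W B" "\<forall>(w, b) \<in> M. l w = b"
    using hom_of_graph[OF W.is_group B.is_group M single] by auto
  moreover have "\<psi> (l w) = \<mu> w" if w: "w \<in> carrier W" for w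
  proof -
    obtain b where "(w, b) \<in> M" using w unfolding \<open>fst ` M = carrier W\<close>[symmetric] by auto
    then show ?thesis using lift[of w b] \<open>\<forall>(w, b) \<in> M. l w = b\<close> by fastforce
  qed
  ultimately show ?thesis by blast
qed

section \<open>The rational hull\<close>

text \<open>
  The sequences that eventually satisfy \<open>s (n + 1) = (n + 1) s n\<close> in additive notation: eventually, they are those
  of the form \<open>n! q\<close> for an element \<open>q\<close> of the rational hull.  In other words, up to null
  sequences this is the direct limit of \<open>G \<rightarrow> G \<rightarrow> G \<rightarrow> \<dots>\<close> along multiplication by \<open>1, 2, 3, \<dots>\<close>, which
  is the tensor product of \<open>G\<close> with the rationals.
\<close>

definition fact_seq_group :: "('a, 'm) monoid_scheme \<Rightarrow> (nat \<Rightarrow> 'a) monoid"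
  where "fact_seq_group G =
    \<lparr>carrier = {s. (\<forall>n. s n \<in> carrier G) \<and> (\<exists>N. \<forall>n\<ge>N. s (Suc n) = s n [^]\<^bsub>G\<^esub> Suc n)},
     monoid.mult = (\<lambda>s t n. s n \<otimes>\<^bsub>G\<^esub> t n), one = (\<lambda>n. \<one>\<^bsub>G\<^esub>)\<rparr>"

definition null_seqs :: "('a, 'm) monoid_scheme \<Rightarrow> (nat \<Rightarrow> 'a) set"
  where "null_seqs G = {s \<in> carrier (fact_seq_group G). \<exists>N. \<forall>n\<ge>N. s n = \<one>\<^bsub>G\<^esub>}"

definition rational_hull :: "('a, 'm) monoid_scheme \<Rightarrow> (nat \<Rightarrow> 'a) set monoid"
  where "rational_hull G = fact_seq_group G Mod null_seqs G"

definition to_hull :: "('a, 'm) monoid_scheme \<Rightarrow> 'a \<Rightarrow> (nat \<Rightarrow> 'a) set"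
  where "to_hull G x = null_seqs G #>\<^bsub>fact_seq_group G\<^esub> (\<lambda>n. x [^]\<^bsub>G\<^esub> (fact n :: nat))"

lemma fact_seq_group_simps [simp]:
  "s \<otimes>\<^bsub>fact_seq_group G\<^esub> t = (\<lambda>n. s n \<otimes>\<^bsub>G\<^esub> t n)" "\<one>\<^bsub>fact_seq_group G\<^esub> = (\<lambda>n. \<one>\<^bsub>G\<^esub>)"
  by (simp_all add: fact_seq_group_def)

lemma fact_seq_group_pow [simp]:
  "s [^]\<^bsub>fact_seq_group G\<^esub> (k::nat) = (\<lambda>n. s n [^]\<^bsub>G\<^esub> k)"
  by (induction k) simp_all

lemma mem_fact_seq_group:
  "s \<in> carrier (fact_seq_group G) \<longleftrightarrow>
    (\<forall>n. s n \<in> carrier G) \<and> (\<exists>N. \<forall>n\<ge>N. s (Suc n) = s n [^]\<^bsub>G\<^esub> Suc n)"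
  by (simp add: fact_seq_group_def)

lemma multiple_beyond:
  assumes "(k::nat) > 0"
  shows "\<exists>m\<ge>M. \<exists>j. Suc m = k * j"
proof -
  have "Suc (k * Suc M - 1) = k * Suc M" "k * Suc M - 1 \<ge> M" using assms by (cases k; simp)+
  then show ?thesis by blast
qed

context comm_group
begin

lemma comm_group_fact_seq_group: "comm_group (fact_seq_group G)"
proof (rule comm_groupI)
  fix s t assume s: "s \<in> carrier (fact_seq_group G)" and t: "t \<in> carrier (fact_seq_group G)"
  obtain M where M: "\<And>n. n \<ge> M \<Longrightarrow> s (Suc n) = s n [^] Suc n"
    using s by (auto simp only: mem_fact_seq_group)
  obtain N where N: "\<And>n. n \<ge> N \<Longrightarrow> t (Suc n) = t n [^] Suc n"
    using t by (auto simp only: mem_fact_seq_group)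
  have c: "s n \<in> carrier G" "t n \<in> carrier G" for n using s t by (auto simp only: mem_fact_seq_group)
  have "s (Suc n) \<otimes> t (Suc n) = (s n \<otimes> t n) [^] Suc n" if "n \<ge> max M N" for n
    using M[of n] N[of n] that c nat_pow_distrib[of "s n" "t n" "Suc n"] by simp
  then show "s \<otimes>\<^bsub>fact_seq_group G\<^esub> t \<in> carrier (fact_seq_group G)"
    unfolding mem_fact_seq_group fact_seq_group_simps using c by blast
  show "s \<otimes>\<^bsub>fact_seq_group G\<^esub> t = t \<otimes>\<^bsub>fact_seq_group G\<^esub> s"
    using c by (simp add: m_comm)
  show "\<one>\<^bsub>fact_seq_group G\<^esub> \<otimes>\<^bsub>fact_seq_group G\<^esub> s = s" using c by simp
  have "inv s (Suc n) = (inv s n) [^] Suc n" if "n \<ge> M" for n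
    using M[OF that] c nat_pow_inv[of "s n" "Suc n"] by simp
  then have "(\<lambda>n. inv s n) \<in> carrier (fact_seq_group G)"
    unfolding mem_fact_seq_group using c by blast
  then show "\<exists>u \<in> carrier (fact_seq_group G). u \<otimes>\<^bsub>fact_seq_group G\<^esub> s = \<one>\<^bsub>fact_seq_group G\<^esub>"
    using c by (intro bexI[of _ "\<lambda>n. inv s n"]) simp_all
next
  fix s t u
  assume "s \<in> carrier (fact_seq_group G)" "t \<in> carrier (fact_seq_group G)" "u \<in> carrier (fact_seq_group G)"
  then have "s n \<in> carrier G" "t n \<in> carrier G" "u n \<in> carrier G" for n
    by (auto simp only: mem_fact_seq_group)
  then show "(s \<otimes>\<^bsub>fact_seq_group G\<^esub> t) \<otimes>\<^bsub>fact_seq_group G\<^esub> u =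
      s \<otimes>\<^bsub>fact_seq_group G\<^esub> (t \<otimes>\<^bsub>fact_seq_group G\<^esub> u)"
    by (simp add: m_assoc)
next
  show "\<one>\<^bsub>fact_seq_group G\<^esub> \<in> carrier (fact_seq_group G)"
    unfolding mem_fact_seq_group fact_seq_group_simps using nat_pow_one by simp
qed

lemma fact_seq_group_inv:
  assumes "s \<in> carrier (fact_seq_group G)"
  shows "inv\<^bsub>fact_seq_group G\<^esub> s = (\<lambda>n. inv s n)"
proof -
  interpret S: comm_group "fact_seq_group G" by (rule comm_group_fact_seq_group)
  have c: "s n \<in> carrier G" "(inv\<^bsub>fact_seq_group G\<^esub> s) n \<in> carrier G" for n
    using assms S.inv_closed[OF assms] by (auto simp only: mem_fact_seq_group)
  have "(inv\<^bsub>fact_seq_group G\<^esub> s) n \<otimes> s n = \<one>" for n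
    using fun_cong[OF S.l_inv[OF assms], of n] by simp
  then show ?thesis using c inv_equality by (intro ext) metis
qed

lemma subgroup_null_seqs: "subgroup (null_seqs G) (fact_seq_group G)"
proof -
  interpret S: comm_group "fact_seq_group G" by (rule comm_group_fact_seq_group)
  show ?thesis
  proof (rule S.subgroupI)
    show "null_seqs G \<subseteq> carrier (fact_seq_group G)" by (auto simp: null_seqs_def)
    have "\<one>\<^bsub>fact_seq_group G\<^esub> \<in> null_seqs G" using S.one_closed by (simp add: null_seqs_def)
    then show "null_seqs G \<noteq> {}" by blast
    show "inv\<^bsub>fact_seq_group G\<^esub> s \<in> null_seqs G" if "s \<in> null_seqs G" for s
    proof -
      obtain N where "s \<in> carrier (fact_seq_group G)" "\<forall>n\<ge>N. s n = \<one>"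
        using \<open>s \<in> null_seqs G\<close> by (auto simp only: null_seqs_def mem_Collect_eq)
      then show ?thesis
        using S.inv_closed[of s] by (auto simp: null_seqs_def fact_seq_group_inv intro!: exI[of _ N])
    qed
    show "s \<otimes>\<^bsub>fact_seq_group G\<^esub> t \<in> null_seqs G" if "s \<in> null_seqs G" "t \<in> null_seqs G" for s t
    proof -
      obtain M where M: "s \<in> carrier (fact_seq_group G)" "\<forall>n\<ge>M. s n = \<one>"
        using \<open>s \<in> null_seqs G\<close> by (auto simp only: null_seqs_def mem_Collect_eq)
      obtain N where N: "t \<in> carrier (fact_seq_group G)" "\<forall>n\<ge>N. t n = \<one>"
        using \<open>t \<in> null_seqs G\<close> by (auto simp only: null_seqs_def mem_Collect_eq)
      have "\<forall>n\<ge>max M N. s n \<otimes> t n = \<one>" using M N by simp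
      then have "\<exists>K. \<forall>n\<ge>K. (s \<otimes>\<^bsub>fact_seq_group G\<^esub> t) n = \<one>" by (metis fact_seq_group_simps(1))
      then show ?thesis using S.m_closed[OF M(1) N(1)] unfolding null_seqs_def by blast
    qed
  qed
qed

lemma comm_group_rational_hull: "comm_group (rational_hull G)"
  unfolding rational_hull_def
  using comm_group.abelian_FactGroup[OF comm_group_fact_seq_group subgroup_null_seqs] .

lemma hom_null_coset:
  "(#>\<^bsub>fact_seq_group G\<^esub>) (null_seqs G) \<in> hom (fact_seq_group G) (rational_hull G)"
proof -
  interpret S: comm_group "fact_seq_group G" by (rule comm_group_fact_seq_group)
  interpret normal "null_seqs G" "fact_seq_group G"
    using subgroup_null_seqs by (rule S.subgroup_imp_normal)
  show ?thesis unfolding rational_hull_def by (rule r_coset_hom_Mod)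
qed

lemma rational_hull_elim:
  assumes "w \<in> carrier (rational_hull G)"
  obtains s where "s \<in> carrier (fact_seq_group G)" "w = null_seqs G #>\<^bsub>fact_seq_group G\<^esub> s"
  using assms unfolding rational_hull_def carrier_FactGroup by blast

lemma null_coset_eq_one_iff:
  assumes "s \<in> carrier (fact_seq_group G)"
  shows "null_seqs G #>\<^bsub>fact_seq_group G\<^esub> s = \<one>\<^bsub>rational_hull G\<^esub> \<longleftrightarrow> (\<exists>N. \<forall>n\<ge>N. s n = \<one>)"
proof -
  interpret S: comm_group "fact_seq_group G" by (rule comm_group_fact_seq_group)
  have "null_seqs G #>\<^bsub>fact_seq_group G\<^esub> s = null_seqs G \<longleftrightarrow> s \<in> null_seqs G"
    using assms subgroup_null_seqs S.coset_join1 S.coset_join2 subgroup.subset by metis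
  then show ?thesis using assms by (simp add: rational_hull_def null_seqs_def)
qed

lemma null_coset_pow:
  assumes "s \<in> carrier (fact_seq_group G)"
  shows "(null_seqs G #>\<^bsub>fact_seq_group G\<^esub> s) [^]\<^bsub>rational_hull G\<^esub> (k::nat) =
    null_seqs G #>\<^bsub>fact_seq_group G\<^esub> (\<lambda>n. s n [^] k)"
proof -
  interpret S: comm_group "fact_seq_group G" by (rule comm_group_fact_seq_group)
  interpret H: comm_group "rational_hull G" by (rule comm_group_rational_hull)
  interpret group_hom "fact_seq_group G" "rational_hull G" "(#>\<^bsub>fact_seq_group G\<^esub>) (null_seqs G)"
    by unfold_locales (rule hom_null_coset)
  show ?thesis using hom_nat_pow[OF assms, of k] by simp
qed

text \<open>
  A sequence \<open>s\<close> with \<open>s n\<close> of order dividing \<open>k\<close> for large \<open>n\<close> vanishes after the next factor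
  \<open>Suc m\<close> that \<open>k\<close> divides.
\<close>

lemma torsion_free_rational_hull: "torsion_free_group (rational_hull G)"
proof -
  interpret S: comm_group "fact_seq_group G" by (rule comm_group_fact_seq_group)
  interpret H: comm_group "rational_hull G" by (rule comm_group_rational_hull)
  have "w = \<one>\<^bsub>rational_hull G\<^esub>"
    if w: "w \<in> carrier (rational_hull G)" and k: "k > 0" "w [^]\<^bsub>rational_hull G\<^esub> k = \<one>\<^bsub>rational_hull G\<^esub>"
    for w and k :: nat
  proof -
    obtain s where s: "s \<in> carrier (fact_seq_group G)" "w = null_seqs G #>\<^bsub>fact_seq_group G\<^esub> s"
      using w by (rule rational_hull_elim)
    have sk: "(\<lambda>n. s n [^] k) \<in> carrier (fact_seq_group G)" using S.nat_pow_closed[OF s(1), of k] by simp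
    then obtain N where N: "\<And>n. n \<ge> N \<Longrightarrow> s n [^] k = \<one>"
      using k(2) s null_coset_pow null_coset_eq_one_iff[OF sk] by metis
    obtain M where M: "\<And>n. n \<ge> M \<Longrightarrow> s (Suc n) = s n [^] Suc n" and c: "\<And>n. s n \<in> carrier G"
      using s(1) by (auto simp only: mem_fact_seq_group)
    obtain m j where m: "m \<ge> M" "m \<ge> N" "Suc m = k * j"
      using multiple_beyond[OF k(1), of "max M N"] by auto
    have "s n = \<one>" if "n \<ge> Suc m" for n
      using that
    proof (induction n rule: dec_induct)
      case base
      have "s m [^] Suc m = (s m [^] k) [^] j" using c by (simp only: m(3) nat_pow_pow)
      then show ?case using M[OF m(1)] N[OF m(2)] by simp
    next
      case (step n)
      then show ?case using M[of n] m(1) by simp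
    qed
    then show ?thesis using s null_coset_eq_one_iff[OF s(1)] by blast
  qed
  then show ?thesis using torsion_free_iff[OF H.is_group] by blast
qed

lemma null_coset_eqI:
  assumes s: "s \<in> carrier (fact_seq_group G)" and t: "t \<in> carrier (fact_seq_group G)"
    and eq: "\<And>n. n \<ge> N \<Longrightarrow> s n = t n"
  shows "null_seqs G #>\<^bsub>fact_seq_group G\<^esub> s = null_seqs G #>\<^bsub>fact_seq_group G\<^esub> t"
proof -
  interpret S: comm_group "fact_seq_group G" by (rule comm_group_fact_seq_group)
  interpret H: comm_group "rational_hull G" by (rule comm_group_rational_hull)
  interpret q: group_hom "fact_seq_group G" "rational_hull G" "(#>\<^bsub>fact_seq_group G\<^esub>) (null_seqs G)"
    by unfold_locales (rule hom_null_coset)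
  let ?u = "s \<otimes>\<^bsub>fact_seq_group G\<^esub> inv\<^bsub>fact_seq_group G\<^esub> t"
  have u: "?u \<in> carrier (fact_seq_group G)" using s t by (intro S.m_closed S.inv_closed)
  have "t n \<in> carrier G" for n using t by (auto simp only: mem_fact_seq_group)
  then have "?u n = \<one>" if "n \<ge> N" for n using eq[OF that] by (simp add: fact_seq_group_inv[OF t])
  then have "null_seqs G #>\<^bsub>fact_seq_group G\<^esub> ?u = \<one>\<^bsub>rational_hull G\<^esub>"
    using null_coset_eq_one_iff[OF u] by blast
  then have "(null_seqs G #>\<^bsub>fact_seq_group G\<^esub> s) \<otimes>\<^bsub>rational_hull G\<^esub>
      inv\<^bsub>rational_hull G\<^esub> (null_seqs G #>\<^bsub>fact_seq_group G\<^esub> t) = \<one>\<^bsub>rational_hull G\<^esub>"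
    using q.hom_mult[OF s S.inv_closed[OF t]] q.hom_inv[OF t] by metis
  then show ?thesis
    using q.hom_closed[OF s] q.hom_closed[OF t] by (metis H.inv_closed H.inv_equality H.inv_inv)
qed

text \<open>
  To divide \<open>s\<close> by \<open>k\<close>, wait for a factor \<open>Suc m = k * j\<close> and use only \<open>j\<close> in place of it; from
  then on the sequence follows the recursion.
\<close>

lemma divisible_rational_hull: "divisible_group (rational_hull G)"
  unfolding divisible_group_def
proof (intro ballI allI impI)
  fix w and k :: nat assume w: "w \<in> carrier (rational_hull G)" and k: "k > 0"
  obtain s where s: "s \<in> carrier (fact_seq_group G)" "w = null_seqs G #>\<^bsub>fact_seq_group G\<^esub> s"
    using w by (rule rational_hull_elim)
  obtain M where M: "\<And>n. n \<ge> M \<Longrightarrow> s (Suc n) = s n [^] Suc n" and c: "\<And>n. s n \<in> carrier G"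
    using s(1) by (auto simp only: mem_fact_seq_group)
  obtain m j where m: "m \<ge> M" "Suc m = k * j" using multiple_beyond[OF k, of M] by auto
  define t where "t = rec_nat \<one> (\<lambda>n x. if n = m then s m [^] j else x [^] Suc n)"
  have t_Suc: "t (Suc n) = (if n = m then s m [^] j else t n [^] Suc n)" for n
    by (simp add: t_def)
  have t_closed: "t n \<in> carrier G" for n
  proof (induction n)
    case 0
    show ?case by (simp add: t_def)
  next
    case (Suc n)
    then show ?case unfolding t_Suc using c by (metis nat_pow_closed)
  qed
  have "t (Suc n) = t n [^] Suc n" if "n \<ge> Suc m" for n using that t_Suc[of n] by simp
  then have t: "t \<in> carrier (fact_seq_group G)" unfolding mem_fact_seq_group using t_closed by blast
  have eq: "t n [^] k = s n" if "n \<ge> Suc m" for n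
    using that
  proof (induction n rule: dec_induct)
    case base
    have "t (Suc m) [^] k = s m [^] (j * k)" using c nat_pow_pow[of "s m" j k] by (simp add: t_Suc)
    also have "j * k = Suc m" using m(2) by simp
    finally show ?case using M[OF m(1)] by simp
  next
    case (step n)
    then have "t (Suc n) [^] k = t n [^] (Suc n * k)"
      using nat_pow_pow[OF t_closed, of n "Suc n" k] by (simp add: t_Suc)
    also have "\<dots> = (t n [^] k) [^] Suc n"
      using nat_pow_pow[OF t_closed, of n k "Suc n"] by (simp only: mult.commute)
    also have "\<dots> = s (Suc n)" using step M[of n] m(1) by simp
    finally show ?case .
  qed
  interpret S: comm_group "fact_seq_group G" by (rule comm_group_fact_seq_group)
  interpret q: group_hom "fact_seq_group G" "rational_hull G" "(#>\<^bsub>fact_seq_group G\<^esub>) (null_seqs G)"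
    by (intro group_hom.intro group_hom_axioms.intro hom_null_coset S.is_group
        comm_group.axioms(2)[OF comm_group_rational_hull])
  have "(\<lambda>n. t n [^] k) \<in> carrier (fact_seq_group G)" using S.nat_pow_closed[OF t, of k] by simp
  from null_coset_eqI[OF this s(1) eq]
  have "(null_seqs G #>\<^bsub>fact_seq_group G\<^esub> t) [^]\<^bsub>rational_hull G\<^esub> k = w"
    using null_coset_pow[OF t, of k] s(2) by simp
  then show "\<exists>v \<in> carrier (rational_hull G). v [^]\<^bsub>rational_hull G\<^esub> k = w"
    using q.hom_closed[OF t] by blast
qed

lemma fact_powers_closed:
  assumes "x \<in> carrier G"
  shows "(\<lambda>n. x [^] (fact n :: nat)) \<in> carrier (fact_seq_group G)"
proof -
  have "x [^] (fact (Suc n) :: nat) = (x [^] (fact n :: nat)) [^] Suc n" for n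
    using nat_pow_pow[OF assms, of "fact n" "Suc n"] by (simp add: mult.commute)
  then show ?thesis unfolding mem_fact_seq_group using assms by blast
qed

lemma hom_to_hull: "to_hull G \<in> hom G (rational_hull G)"
proof -
  have "(\<lambda>x n. x [^] (fact n :: nat)) \<in> hom G (fact_seq_group G)"
    by (rule homI) (simp_all add: fact_powers_closed nat_pow_distrib)
  from Group.hom_compose[OF this hom_null_coset] show ?thesis by (simp add: to_hull_def[abs_def] comp_def)
qed

text \<open>
  The kernel of the map into the rational hull is the torsion part, because \<open>m\<close> divides
  \<open>fact n\<close> for all \<open>n \<ge> m\<close>.
\<close>

lemma to_hull_eq_one_iff:
  assumes x: "x \<in> carrier G"
  shows "to_hull G x = \<one>\<^bsub>rational_hull G\<^esub> \<longleftrightarrow> (\<exists>n::nat. n > 0 \<and> x [^] n = \<one>)"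
proof -
  have "(\<exists>N. \<forall>n\<ge>N. x [^] (fact n :: nat) = \<one>) \<longleftrightarrow> (\<exists>n::nat. n > 0 \<and> x [^] n = \<one>)"
  proof
    assume "\<exists>N. \<forall>n\<ge>N. x [^] (fact n :: nat) = \<one>"
    then show "\<exists>n::nat. n > 0 \<and> x [^] n = \<one>" using fact_gt_zero order_refl by blast
  next
    assume "\<exists>n::nat. n > 0 \<and> x [^] n = \<one>"
    then obtain m :: nat where m: "m > 0" "x [^] m = \<one>" by blast
    have "x [^] (fact n :: nat) = \<one>" if "n \<ge> m" for n
    proof -
      have "m dvd fact n" using m(1) that by (intro dvd_fact) auto
      then obtain i where "(fact n :: nat) = m * i" by (rule dvdE)
      then show ?thesis using nat_pow_pow[OF x, of m i] m(2) by simp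
    qed
    then show "\<exists>N. \<forall>n\<ge>N. x [^] (fact n :: nat) = \<one>" by blast
  qed
  then show ?thesis
    using null_coset_eq_one_iff[OF fact_powers_closed[OF x]] by (simp only: to_hull_def)
qed

end

section \<open>Extending homomorphisms along t-extensions\<close>

lemma divisible_group_extends:
  assumes "extension Z X (Y, \<phi>, \<psi>)" and T: "comm_group T" "divisible_group T" and f: "f \<in> hom X T"
  shows "\<exists>g \<in> hom Y T. \<forall>x \<in> carrier X. g (\<phi> x) = f x"
proof -
  interpret comm_short_exact X Y Z \<phi> \<psi> using assms(1) by (simp add: extension_iff)
  interpret T: comm_group T by fact
  interpret f: group_hom X T f by unfold_locales (rule f)
  have "f x = \<one>\<^bsub>T\<^esub>" if "x \<in> carrier X" "\<phi> x = \<one>\<^bsub>Y\<^esub>" for x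
    using inj_onD[OF inj_phi, of x "\<one>\<^bsub>X\<^esub>"] that by simp
  from hom_factor_through_image[OF A.is_group B.is_group T.is_group hom_phi f this]
  obtain f' where f': "f' \<in> hom (Y\<lparr>carrier := \<phi> ` carrier X\<rparr>) T" "\<And>x. x \<in> carrier X \<Longrightarrow> f' (\<phi> x) = f x"
    by blast
  from divisible_group_injective[OF B.comm_group_axioms T phi.img_is_subgroup f'(1)]
  show ?thesis using f'(2) by fastforce
qed

lemma extension_of_injective_hom:
  assumes "comm_group A" "comm_group B" "\<phi> \<in> hom A B" "inj_on \<phi> (carrier A)"
  shows "extension (B Mod \<phi> ` carrier A) A (B, \<phi>, (#>\<^bsub>B\<^esub>) (\<phi> ` carrier A))"
proof -
  interpret A: comm_group A by fact
  interpret B: comm_group B by fact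
  interpret phi: group_hom A B \<phi> by unfold_locales (rule assms(3))
  let ?N = "\<phi> ` carrier A"
  have N: "subgroup ?N B" by (rule phi.img_is_subgroup)
  interpret N: normal ?N B using N by (rule B.subgroup_imp_normal)
  have coset: "?N #>\<^bsub>B\<^esub> b = ?N \<longleftrightarrow> b \<in> ?N" if "b \<in> carrier B" for b
    using that N B.coset_join1 B.coset_join2 subgroup.subset[OF N] by metis
  have "kernel B (B Mod ?N) ((#>\<^bsub>B\<^esub>) ?N) = ?N"
    using coset subgroup.subset[OF N] unfolding kernel_def one_FactGroup by blast
  then show ?thesis
    using assms B.abelian_FactGroup[OF N] N.r_coset_hom_Mod
    by (simp add: extension_def short_exact_def carrier_FactGroup)
qed

lemma divisible_group_image:
  assumes "h \<in> hom G H" "group G" "group H" "h ` carrier G = carrier H" "divisible_group G"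
  shows "divisible_group H"
  unfolding divisible_group_def
proof (intro ballI allI impI)
  interpret group_hom G H h using assms by (simp add: group_hom_def group_hom_axioms_def)
  fix x and n :: nat assume "x \<in> carrier H" "n > 0"
  then obtain g where g: "g \<in> carrier G" "x = h g" using assms(4) by blast
  then obtain k where "k \<in> carrier G" "k [^]\<^bsub>G\<^esub> n = g"
    using assms(5) \<open>n > 0\<close> unfolding divisible_group_def by blast
  then show "\<exists>y \<in> carrier H. y [^]\<^bsub>H\<^esub> n = x"
    using g(2) hom_nat_pow[of k n] by (intro bexI[of _ "h k"]) auto
qed

text \<open>
  The group \<open>Ext\<close> from a torsion-free group to \<open>D\<close> vanishes, and t-exactness is what
  allows the torsion of \<open>Z\<close> to be ignored.  In the notation of the proof, \<open>f\<close> is first extended to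
  \<open>h\<close> with values in the rational hull \<open>V\<close> of \<open>D\<close>; the error modulo \<open>D\<close> is a homomorphism \<open>\<mu>\<close> on the
  rational hull \<open>W\<close> of \<open>Z\<close>, and a lift \<open>l\<close> of \<open>\<mu>\<close> corrects \<open>h\<close>.
\<close>

theorem torsion_free_cotorsion_extends:
  assumes t: "t_extension Z X (Y, \<phi>, \<psi>)"
    and D: "comm_group D" "torsion_free_group D" "cotorsion_group D" and f: "f \<in> hom X D"
  shows "\<exists>g \<in> hom Y D. \<forall>x \<in> carrier X. g (\<phi> x) = f x"
proof -
  have E: "extension Z X (Y, \<phi>, \<psi>)"
    and torsion: "carrier (torsion_part Z) \<subseteq> \<psi> ` carrier (torsion_part Y)"
    using t by (simp_all add: t_extension_iff)
  interpret comm_short_exact X Y Z \<phi> \<psi> using E by (simp add: extension_iff)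
  interpret D: comm_group D by fact
  let ?V = "rational_hull D" and ?W = "rational_hull Z" and ?\<iota> = "to_hull D" and ?\<kappa> = "to_hull Z"
  interpret V: comm_group ?V by (rule D.comm_group_rational_hull)
  interpret W: comm_group ?W by (rule C.comm_group_rational_hull)
  interpret iota: group_hom D ?V ?\<iota> by unfold_locales (rule D.hom_to_hull)
  interpret kappa: group_hom Z ?W ?\<kappa> by unfold_locales (rule C.hom_to_hull)
  have "inj_on ?\<iota> (carrier D)"
    using D(2) D.to_hull_eq_one_iff torsion_free_iff[OF D.is_group] iota.inj_on_one_iff by metis
  note ext = extension_of_injective_hom[OF D(1) V.comm_group_axioms iota.homh this]
  let ?C = "?V Mod ?\<iota> ` carrier D" and ?\<pi> = "(#>\<^bsub>?V\<^esub>) (?\<iota> ` carrier D)"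
  interpret V: comm_short_exact D ?V ?C ?\<iota> ?\<pi> using ext by (simp add: extension_iff)
  have "?\<iota> \<circ> f \<in> hom X ?V" using f iota.homh by (rule hom_compose)
  from divisible_group_extends[OF E V.comm_group_axioms D.divisible_rational_hull this]
  obtain h where h: "h \<in> hom Y ?V" "\<And>x. x \<in> carrier X \<Longrightarrow> h (\<phi> x) = ?\<iota> (f x)" by auto
  interpret h: group_hom Y ?V h by unfold_locales (rule h)
  have f_closed: "f x \<in> carrier D" if "x \<in> carrier X" for x using f that by (rule hom_in_carrier)
  have h_torsion: "h y = \<one>\<^bsub>?V\<^esub>" if "y \<in> carrier (torsion_part Y)" for y
    using hom_torsion[OF h.group_hom_axioms that] D.torsion_free_rational_hull
    by (simp add: torsion_free_group_def)
  have p: "?\<kappa> \<circ> \<psi> \<in> hom Y ?W" using hom_psi kappa.homh by (rule hom_compose)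
  have q: "?\<pi> \<circ> h \<in> hom Y ?C" using h(1) V.hom_psi by (rule hom_compose)
  \<comment> \<open>An element of \<open>Y\<close> that dies in \<open>W\<close> differs from a torsion element by an element of \<open>X\<close>.\<close>
  have "(?\<pi> \<circ> h) y = \<one>\<^bsub>?C\<^esub>" if y: "y \<in> carrier Y" and "(?\<kappa> \<circ> \<psi>) y = \<one>\<^bsub>?W\<^esub>" for y
  proof -
    have "\<psi> y \<in> carrier (torsion_part Z)"
      using that C.to_hull_eq_one_iff[of "\<psi> y"] by (simp add: mem_torsion_part)
    then obtain s where s: "s \<in> carrier (torsion_part Y)" "\<psi> y = \<psi> s" using torsion by blast
    then have sY: "s \<in> carrier Y" by (simp add: mem_torsion_part)
    obtain x where x: "x \<in> carrier X" "y = \<phi> x \<otimes>\<^bsub>Y\<^esub> s" using y sY s(2) by (rule psi_eqE)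
    then have "h y = ?\<iota> (f x)" using h(2) h_torsion[OF s(1)] sY f_closed by simp
    then show ?thesis using x(1) f_closed V.psi_phi by simp
  qed
  from hom_factor_through_image[OF B.is_group W.is_group V.C.is_group p q this]
  obtain m where m: "m \<in> hom (?W\<lparr>carrier := (?\<kappa> \<circ> \<psi>) ` carrier Y\<rparr>) ?C"
    "\<And>y. y \<in> carrier Y \<Longrightarrow> m (?\<kappa> (\<psi> y)) = ?\<pi> (h y)" by auto
  have C_div: "divisible_group ?C"
    using divisible_group_image[OF V.hom_psi V.is_group V.C.is_group V.surj_psi D.divisible_rational_hull] .
  interpret p: group_hom Y ?W "?\<kappa> \<circ> \<psi>" by unfold_locales (rule p)
  \<comment> \<open>The quotient of \<open>V\<close> by \<open>D\<close> is divisible, so the induced map extends from the image of \<open>Y\<close> to all of \<open>W\<close>.\<close>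
  from divisible_group_injective[OF W.comm_group_axioms V.C.comm_group_axioms C_div p.img_is_subgroup m(1)]
  obtain \<mu> where \<mu>: "\<mu> \<in> hom ?W ?C" "\<And>y. y \<in> carrier Y \<Longrightarrow> \<mu> (?\<kappa> (\<psi> y)) = ?\<pi> (h y)"
    using m(2) by auto
  from cotorsion_lift_divisible[OF D(3) ext W.comm_group_axioms C.divisible_rational_hull
      C.torsion_free_rational_hull \<mu>(1)]
  obtain l where l: "l \<in> hom ?W ?V" "\<And>w. w \<in> carrier ?W \<Longrightarrow> ?\<pi> (l w) = \<mu> w" by blast
  interpret l: group_hom ?W ?V l by unfold_locales (rule l)
  define k where "k y = h y \<otimes>\<^bsub>?V\<^esub> inv\<^bsub>?V\<^esub> l (?\<kappa> (\<psi> y))" for y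
  have "?\<pi> (k y) = \<one>\<^bsub>?C\<^esub>" if "y \<in> carrier Y" for y
    using that \<mu>(2) l(2) by (simp add: k_def del: mult_FactGroup one_FactGroup)
  moreover have "k y \<in> carrier ?V" if "y \<in> carrier Y" for y using that by (simp add: k_def)
  ultimately have k_image: "k y \<in> ?\<iota> ` carrier D" if "y \<in> carrier Y" for y
    using that V.kernel_psiE by (metis imageI)
  have k: "k \<in> hom Y (?V\<lparr>carrier := ?\<iota> ` carrier D\<rparr>)"
    using k_image by (intro homI) (simp_all add: k_def V.inv_mult V.m_ac)
  from hom_factor_through_image[OF D.is_group V.is_group D.is_group iota.homh, of id]
  obtain j where j: "j \<in> hom (?V\<lparr>carrier := ?\<iota> ` carrier D\<rparr>) D" "\<And>d. d \<in> carrier D \<Longrightarrow> j (?\<iota> d) = d"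
    using V.inj_phi by (auto simp: iota.inj_on_one_iff id_def hom_def)
  have "j \<circ> k \<in> hom Y D" using k j(1) by (rule hom_compose)
  moreover have "(j \<circ> k) (\<phi> x) = f x" if "x \<in> carrier X" for x
    using that h(2) f_closed j(2) by (simp add: k_def)
  ultimately show ?thesis by blast
qed

lemma torsion_divisible_times_cotorsion_extends:
  assumes A: "comm_group A" and B: "comm_group B" "divisible_group B"
    and D: "comm_group D" "torsion_free_group D" "cotorsion_group D" and iso: "A \<cong> B \<times>\<times> D"
    and t: "t_extension Z X (Y, \<phi>, \<psi>)" and f: "f \<in> hom X A"
  shows "\<exists>g \<in> hom Y A. \<forall>x \<in> carrier X. g (\<phi> x) = f x"
proof -
  interpret A: comm_group A by fact
  obtain i where i: "i \<in> iso A (B \<times>\<times> D)" using iso by (auto simp: is_iso_def)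
  let ?j = "inv_into (carrier A) i"
  have i_hom: "i \<in> hom A (B \<times>\<times> D)" and bij: "bij_betw i (carrier A) (carrier (B \<times>\<times> D))"
    using i by (auto simp: iso_def)
  have j: "?j \<in> hom (B \<times>\<times> D) A" using A.iso_set_sym[OF i] by (simp add: iso_def)
  have if_hom: "i \<circ> f \<in> hom X (B \<times>\<times> D)" using f i_hom by (rule hom_compose)
  then have fB: "fst \<circ> (i \<circ> f) \<in> hom X B" and fD: "snd \<circ> (i \<circ> f) \<in> hom X D"
    by (simp_all add: hom_pairwise)
  obtain gB where gB: "gB \<in> hom Y B" "\<And>x. x \<in> carrier X \<Longrightarrow> gB (\<phi> x) = fst (i (f x))"
    using divisible_group_extends[OF extension_of_t_extension[OF t] B fB] by auto
  obtain gD where gD: "gD \<in> hom Y D" "\<And>x. x \<in> carrier X \<Longrightarrow> gD (\<phi> x) = snd (i (f x))"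
    using torsion_free_cotorsion_extends[OF t D fD] by auto
  have "(\<lambda>y. (gB y, gD y)) \<in> hom Y (B \<times>\<times> D)"
    using gB(1) gD(1) by (simp add: hom_pairwise comp_def)
  then have "?j \<circ> (\<lambda>y. (gB y, gD y)) \<in> hom Y A" using j by (rule hom_compose)
  moreover have "(?j \<circ> (\<lambda>y. (gB y, gD y))) (\<phi> x) = f x" if "x \<in> carrier X" for x
    using that gB(2) gD(2) bij_betw_inv_into_left[OF bij, of "f x"] hom_in_carrier[OF f] by simp
  ultimately show ?thesis by blast
qed

section \<open>Extensions of countable groups\<close>

lemma ex_inj_on_of_countable:
  assumes "countable S" and "infinite (UNIV :: 'u set)"
  shows "\<exists>f :: 'a \<Rightarrow> 'u. inj_on f S"
proof -
  obtain g :: "nat \<Rightarrow> 'u" where "inj g" using infinite_countable_subset[OF assms(2)] by blast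
  moreover obtain f :: "'a \<Rightarrow> nat" where "inj_on f S" using assms(1) by (rule countableE)
  ultimately have "inj_on (g \<circ> f) S" by (meson comp_inj_on inj_on_subset subset_UNIV)
  then show ?thesis by blast
qed

lemma image_group_transport:
  assumes G: "comm_group G" and inj: "inj_on f (carrier G)"
  shows "comm_group (image_group f G)" and "f \<in> iso G (image_group f G)"
proof -
  interpret G: comm_group G by fact
  have inv [simp]: "inv_into (carrier G) f (f x) = x" if "x \<in> carrier G" for x
    using inj that by (rule inv_into_f_f)
  show "comm_group (image_group f G)"
  proof (rule comm_groupI)
    fix x assume "x \<in> carrier (image_group f G)"
    then obtain g where "g \<in> carrier G" "x = f g" by (auto simp: image_group_def)
    then show "\<exists>y\<in>carrier (image_group f G). y \<otimes>\<^bsub>image_group f G\<^esub> x = \<one>\<^bsub>image_group f G\<^esub>"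
      by (intro bexI[of _ "f (inv\<^bsub>G\<^esub> g)"]) (auto simp: image_group_def)
  qed (auto simp: image_group_def G.m_ac)
  show "f \<in> iso G (image_group f G)"
    using inj by (auto simp: iso_def hom_def image_group_def bij_betw_def)
qed

text \<open>
  Every element of the generated subgroup is the product of a list of generators and their
  inverses.
\<close>

lemma countable_generate:
  assumes "group G" and "H \<subseteq> carrier G" and "countable H"
  shows "countable (generate G H)"
proof -
  interpret group G by fact
  let ?L = "H \<union> m_inv G ` H" and ?v = "\<lambda>xs. foldr (\<lambda>x y. x \<otimes>\<^bsub>G\<^esub> y) xs \<one>\<^bsub>G\<^esub>"
  have L: "?L \<subseteq> carrier G" using assms(2) by auto
  have closed: "?v xs \<in> carrier G" if "set xs \<subseteq> ?L" for xs
    using that by (induction xs) (use L in auto)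
  have append: "?v xs \<otimes>\<^bsub>G\<^esub> ?v ys = ?v (xs @ ys)" if "set xs \<subseteq> ?L" "set ys \<subseteq> ?L" for xs ys
    using that(1)
  proof (induction xs)
    case Nil
    then show ?case using closed[OF that(2)] by simp
  next
    case (Cons x xs)
    have "x \<in> carrier G" using Cons.prems L by auto
    then show ?case using Cons closed[of xs] closed[OF that(2)] by (simp add: m_assoc)
  qed
  have "x \<in> ?v ` lists ?L" if "x \<in> generate G H" for x
    using that
  proof (induction rule: generate.induct)
    case one
    show ?case by (rule image_eqI[of _ _ "[]"]) auto
  next
    case (incl h)
    then show ?case using assms(2) by (intro image_eqI[of _ _ "[h]"]) auto
  next
    case (inv h)
    then show ?case using assms(2) by (intro image_eqI[of _ _ "[inv\<^bsub>G\<^esub> h]"]) auto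
  next
    case (eng x y)
    then obtain xs ys where "xs \<in> lists ?L" "ys \<in> lists ?L" "x = ?v xs" "y = ?v ys" by blast
    then show ?case using append[of xs ys] by (intro image_eqI[of _ _ "xs @ ys"]) (auto simp: in_lists_conv_set subset_iff)
  qed
  then have "generate G H \<subseteq> ?v ` lists ?L" by blast
  moreover have "countable (?v ` lists ?L)" using assms(3) by simp
  ultimately show ?thesis by (rule countable_subset)
qed

lemma extension_of_surjective_hom:
  assumes "comm_group Y" "comm_group Z" "\<psi> \<in> hom Y Z" "\<psi> ` carrier Y = carrier Z"
  shows "extension Z (Y\<lparr>carrier := kernel Y Z \<psi>\<rparr>) (Y, \<lambda>x. x, \<psi>)"
proof -
  interpret Y: comm_group Y by fact
  interpret Z: comm_group Z by fact
  interpret psi: group_hom Y Z \<psi> by unfold_locales (rule assms(3))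
  have "comm_group (Y\<lparr>carrier := kernel Y Z \<psi>\<rparr>)"
    using assms(1) psi.subgroup_kernel by (rule subgroup_imp_comm_group)
  moreover have "(\<lambda>x. x) \<in> hom (Y\<lparr>carrier := kernel Y Z \<psi>\<rparr>) Y" by (auto simp: hom_def kernel_def)
  ultimately show ?thesis using assms by (simp add: extension_def short_exact_def)
qed

lemma t_extension_iso:
  assumes t: "t_extension C A (B, \<phi>, \<psi>)" and C': "comm_group C'" and j: "j \<in> iso C C'"
  shows "t_extension C' A (B, \<phi>, j \<circ> \<psi>)"
proof -
  have E: "extension C A (B, \<phi>, \<psi>)"
    and torsion: "carrier (torsion_part C) \<subseteq> \<psi> ` carrier (torsion_part B)"
    using t by (simp_all add: t_extension_iff)
  interpret comm_short_exact A B C \<phi> \<psi> using E by (simp add: extension_iff)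
  interpret C': comm_group C' by fact
  have j_hom: "j \<in> hom C C'" and bij: "bij_betw j (carrier C) (carrier C')" using j by (auto simp: iso_def)
  interpret j: group_hom C C' j by unfold_locales (rule j_hom)
  have one_iff: "j c = \<one>\<^bsub>C'\<^esub> \<longleftrightarrow> c = \<one>\<^bsub>C\<^esub>" if "c \<in> carrier C" for c
    using j.inj_on_one_iff bij that j.hom_one by (auto simp: bij_betw_def)
  have "kernel B C' (j \<circ> \<psi>) = kernel B C \<psi>" using one_iff by (auto simp: kernel_def)
  moreover have "(j \<circ> \<psi>) ` carrier B = carrier C'"
    using surj_psi bij by (simp only: image_comp[symmetric] bij_betw_def)
  ultimately have "extension C' A (B, \<phi>, j \<circ> \<psi>)"
    using E C' hom_compose[OF hom_psi j_hom] by (simp add: extension_def short_exact_def)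
  moreover have "c' \<in> (j \<circ> \<psi>) ` carrier (torsion_part B)" if c': "c' \<in> carrier (torsion_part C')" for c'
  proof -
    obtain n :: nat where n: "c' \<in> carrier C'" "n > 0" "c' [^]\<^bsub>C'\<^esub> n = \<one>\<^bsub>C'\<^esub>"
      using c' by (auto simp: mem_torsion_part)
    then obtain c where c: "c \<in> carrier C" "c' = j c" using bij by (auto simp: bij_betw_def)
    then have "c [^]\<^bsub>C\<^esub> n = \<one>\<^bsub>C\<^esub>" using n(3) one_iff[of "c [^]\<^bsub>C\<^esub> n"] j.hom_nat_pow[of c n] by simp
    then have "c \<in> carrier (torsion_part C)" using c n(2) by (auto simp: mem_torsion_part)
    then show ?thesis using torsion c(2) by auto
  qed
  ultimately show ?thesis by (auto simp: t_extension_iff)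
qed

text \<open>
  The group \<open>A\<close> may be too large for the type \<open>'u\<close>.  However, \<open>B\<close> is the sum of \<open>A\<close> and
  any subgroup \<open>K\<close> that maps onto \<open>C\<close>, and \<open>K\<close> can be chosen countable.  The t-extension of \<open>C\<close> with middle group
  \<open>K\<close> has a copy in \<open>'u\<close>; t-injectivity extends the inclusion of \<open>A \<inter> K\<close> in \<open>A\<close> to \<open>K\<close>, and
  together with the identity of \<open>A\<close> this gives a retraction of \<open>B\<close>.
\<close>

lemma t_injective_splits:
  fixes C :: "'u monoid"
  assumes inj: "t_injective TYPE('u) A" and U: "infinite (UNIV :: 'u set)"
    and t: "t_extension C A (B, \<phi>, \<psi>)" and C: "countable (carrier C)"
  shows "splits A (B, \<phi>, \<psi>)"
proof -
  have E: "extension C A (B, \<phi>, \<psi>)"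
    and torsion: "carrier (torsion_part C) \<subseteq> \<psi> ` carrier (torsion_part B)"
    using t by (simp_all add: t_extension_iff)
  interpret comm_short_exact A B C \<phi> \<psi> using E by (simp add: extension_iff)
  have "\<exists>b. b \<in> carrier B \<and> \<psi> b = c \<and> (c \<in> carrier (torsion_part C) \<longrightarrow> b \<in> carrier (torsion_part B))"
    if "c \<in> carrier C" for c
  proof (cases "c \<in> carrier (torsion_part C)")
    case True
    then obtain b where "b \<in> carrier (torsion_part B)" "\<psi> b = c" using torsion by blast
    then show ?thesis by (auto simp: mem_torsion_part)
  next
    case False
    then show ?thesis using psi_surjE[OF that] by metis
  qed
  then obtain s where s: "\<And>c. c \<in> carrier C \<Longrightarrow> s c \<in> carrier B" "\<And>c. c \<in> carrier C \<Longrightarrow> \<psi> (s c) = c"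
    "\<And>c. c \<in> carrier (torsion_part C) \<Longrightarrow> s c \<in> carrier (torsion_part B)"
    by (metis mem_torsion_part)
  \<comment> \<open>Torsion elements were lifted to torsion elements, so \<open>K\<close> is the middle group of a t-extension.\<close>
  define K where "K = generate B (s ` carrier C)"
  have sub: "s ` carrier C \<subseteq> carrier B" using s(1) by blast
  have K: "subgroup K B" unfolding K_def using sub by (rule B.generate_is_subgroup)
  have sK: "s c \<in> K" if "c \<in> carrier C" for c using that by (auto simp: K_def intro: generate.incl)
  have "countable K" unfolding K_def using sub C by (intro countable_generate) auto
  then obtain i :: "'b \<Rightarrow> 'u" where i: "inj_on i K" using ex_inj_on_of_countable U by blast
  let ?K = "B\<lparr>carrier := K\<rparr>"
  let ?Y = "image_group i ?K"
  have comm_K: "comm_group ?K" using B.comm_group_axioms K by (rule subgroup_imp_comm_group)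
  then have Y: "comm_group ?Y" and i_iso: "i \<in> iso ?K ?Y"
    using image_group_transport[of ?K i] i by simp_all
  interpret K: comm_group ?K by (rule comm_K)
  interpret Y: comm_group ?Y by (rule Y)
  let ?i' = "inv_into K i"
  have i_hom: "i \<in> hom ?K ?Y" using i_iso by (simp add: iso_def)
  have i'_hom: "?i' \<in> hom ?Y ?K" using K.iso_set_sym[OF i_iso] by (simp add: iso_def)
  interpret i: group_hom ?K ?Y i by unfold_locales (rule i_hom)
  have i'_i: "?i' (i x) = x" if "x \<in> K" for x using i that by (rule inv_into_f_f)
  have KB: "x \<in> carrier B" if "x \<in> K" for x using subgroup.mem_carrier[OF K that] .
  have "\<psi> \<in> hom ?K C" using hom_psi KB by (auto simp: hom_def)
  with i'_hom have psi': "\<psi> \<circ> ?i' \<in> hom ?Y C" by (rule hom_compose)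
  have Y_carrier: "carrier ?Y = i ` K" by (simp add: image_group_def)
  have "(\<psi> \<circ> ?i') ` carrier ?Y = \<psi> ` K" using i'_i by (force simp: Y_carrier)
  also have "\<dots> = carrier C" using s(2) sK KB by force
  finally have "extension C (?Y\<lparr>carrier := kernel ?Y C (\<psi> \<circ> ?i')\<rparr>) (?Y, \<lambda>x. x, \<psi> \<circ> ?i')"
    by (intro extension_of_surjective_hom Y C.comm_group_axioms psi')
  moreover have "c \<in> (\<psi> \<circ> ?i') ` carrier (torsion_part ?Y)" if c: "c \<in> carrier (torsion_part C)" for c
  proof -
    have cC: "c \<in> carrier C" using c by (simp add: mem_torsion_part)
    obtain n :: nat where n: "n > 0" "s c [^]\<^bsub>B\<^esub> n = \<one>\<^bsub>B\<^esub>" using s(3)[OF c] by (auto simp: mem_torsion_part)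
    then have "s c [^]\<^bsub>?K\<^esub> n = \<one>\<^bsub>?K\<^esub>" using B.nat_pow_consistent[of "s c" n K] by simp
    then have "s c \<in> carrier (torsion_part ?K)" using n(1) sK[OF cC] by (auto simp: mem_torsion_part)
    then have "i (s c) \<in> carrier (torsion_part ?Y)" by (rule hom_torsion[OF i.group_hom_axioms])
    then show ?thesis using i'_i[OF sK[OF cC]] s(2)[OF cC] by (intro image_eqI[of _ _ "i (s c)"]) auto
  qed
  ultimately have tY: "t_extension C (?Y\<lparr>carrier := kernel ?Y C (\<psi> \<circ> ?i')\<rparr>) (?Y, \<lambda>x. x, \<psi> \<circ> ?i')"
    by (auto simp: t_extension_iff)
  have "a = \<one>\<^bsub>A\<^esub>" if "a \<in> carrier A" "\<phi> a = \<one>\<^bsub>B\<^esub>" for a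
    using inj_onD[OF inj_phi, of a "\<one>\<^bsub>A\<^esub>"] that by simp
  then have "\<exists>p \<in> hom (B\<lparr>carrier := \<phi> ` carrier A\<rparr>) A. \<forall>a \<in> carrier A. p (\<phi> a) = id a"
    using hom_factor_through_image[OF A.is_group B.is_group A.is_group hom_phi, of id] by (auto simp: hom_def)
  then obtain p where p: "p \<in> hom (B\<lparr>carrier := \<phi> ` carrier A\<rparr>) A" "\<And>a. a \<in> carrier A \<Longrightarrow> p (\<phi> a) = a"
    by auto
  have i'_ker: "?i' x \<in> \<phi> ` carrier A" if x: "x \<in> kernel ?Y C (\<psi> \<circ> ?i')" for x
  proof -
    obtain y where y: "y \<in> K" "x = i y" using x by (auto simp: kernel_def Y_carrier)
    then show ?thesis using x i'_i[OF y(1)] KB[OF y(1)] image_phi by (auto simp: kernel_def)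
  qed
  have "?i' \<in> hom (?Y\<lparr>carrier := kernel ?Y C (\<psi> \<circ> ?i')\<rparr>) (B\<lparr>carrier := \<phi> ` carrier A\<rparr>)"
    using i'_hom i'_ker by (auto simp: hom_def kernel_def)
  then have "p \<circ> ?i' \<in> hom (?Y\<lparr>carrier := kernel ?Y C (\<psi> \<circ> ?i')\<rparr>) A" using p(1) by (rule hom_compose)
  with tY inj obtain g where g: "g \<in> hom ?Y A"
    "\<And>x. x \<in> kernel ?Y C (\<psi> \<circ> ?i') \<Longrightarrow> g x = p (?i' x)"
    unfolding t_injective_def by fastforce
  have gi: "g \<circ> i \<in> hom ?K A" using i_hom g(1) by (rule hom_compose)
  have agree: "p x = (g \<circ> i) x" if x: "x \<in> \<phi> ` carrier A" "x \<in> K" for x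
  proof -
    have "\<psi> x = \<one>\<^bsub>C\<^esub>" using x(1) by auto
    then have "i x \<in> kernel ?Y C (\<psi> \<circ> ?i')" using x(2) i'_i[OF x(2)] by (simp add: kernel_def Y_carrier)
    then show ?thesis using g(2) i'_i[OF x(2)] by simp
  qed
  obtain r where r: "r \<in> hom (B\<lparr>carrier := \<phi> ` carrier A <#>\<^bsub>B\<^esub> K\<rparr>) A"
    "\<And>x y. x \<in> \<phi> ` carrier A \<Longrightarrow> y \<in> K \<Longrightarrow> r (x \<otimes>\<^bsub>B\<^esub> y) = p x \<otimes>\<^bsub>A\<^esub> (g \<circ> i) y"
    using hom_amalgamate[OF B.comm_group_axioms A.comm_group_axioms phi.img_is_subgroup K p(1) gi agree]
    by blast
  have "b \<in> \<phi> ` carrier A <#>\<^bsub>B\<^esub> K" if b: "b \<in> carrier B" for b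
  proof -
    have c: "\<psi> b \<in> carrier C" using b by simp
    obtain a where "a \<in> carrier A" "b = \<phi> a \<otimes>\<^bsub>B\<^esub> s (\<psi> b)"
      using b s(1)[OF c] s(2)[OF c, symmetric] by (rule psi_eqE)
    then show ?thesis using sK[OF c] unfolding set_mult_def by blast
  qed
  moreover have "\<phi> ` carrier A <#>\<^bsub>B\<^esub> K \<subseteq> carrier B"
    using KB by (auto simp: set_mult_def)
  ultimately have "\<phi> ` carrier A <#>\<^bsub>B\<^esub> K = carrier B" by blast
  then have r_hom: "r \<in> hom B A" using r(1) by simp
  have "r (\<phi> a) = a" if a: "a \<in> carrier A" for a
  proof -
    have "(g \<circ> i) \<one>\<^bsub>B\<^esub> = \<one>\<^bsub>A\<^esub>" using hom_one[OF gi K.is_group A.is_group] by simp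
    then show ?thesis
      using r(2)[of "\<phi> a" "\<one>\<^bsub>B\<^esub>"] a p(2)[OF a] subgroup.one_closed[OF K] by simp
  qed
  then show ?thesis using r_hom by (auto simp: splits_def)
qed

lemma Ext_t_trivial_splits:
  fixes C :: "'u monoid" and A :: "'a monoid"
  assumes "carrier (Ext_t C A) = {\<one>\<^bsub>Ext_t C A\<^esub>}" and t: "t_extension C A E"
  shows "splits A E"
proof -
  have E: "extension C A E" using t by (rule extension_of_t_extension)
  then have A: "comm_group A" and C: "comm_group C" by (cases E; simp add: extension_def)+
  obtain E' where "E' \<in> ext_class C A E" using ext_class_nonempty[OF E] by blast
  then have E': "extension C A E'" "ext_equiv A E' E" by (auto simp: ext_class_def)
  have "t_extension C A E'" using E'(2,1) t by (rule t_extension_of_ext_equiv)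
  then have "splits A E'" using assms(1) unfolding Ext_t_trivial_iff[OF A C] by blast
  with ext_equiv_sym[OF E'(1) E E'(2)] show ?thesis by (rule splits_of_ext_equiv)
qed

text \<open>
  Whether an extension splits depends only on the map \<open>\<phi>\<close>, so \<open>C\<close> may be replaced by an isomorphic
  group with elements in the infinite type.
\<close>

lemma splits_of_splits_in_infinite_type:
  fixes C :: "'c monoid"
  assumes U: "infinite (UNIV :: 'u set)" and C: "countable (carrier C)"
    and t: "t_extension C A (B, \<phi>, \<psi>)"
    and splits: "\<And>(C' :: 'u monoid) \<psi>'. countable (carrier C') \<Longrightarrow>
      t_extension C' A (B, \<phi>, \<psi>') \<Longrightarrow> splits A (B, \<phi>, \<psi>')"
  shows "splits A (B, \<phi>, \<psi>)"
proof -
  obtain j :: "'c \<Rightarrow> 'u" where j: "inj_on j (carrier C)" using ex_inj_on_of_countable[OF C U] by blast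
  have "comm_group C" using t by (simp add: t_extension_def extension_def)
  note image_group_transport[OF this j]
  then have "t_extension (image_group j C) A (B, \<phi>, j \<circ> \<psi>)" using t t_extension_iso by blast
  moreover have "countable (carrier (image_group j C))" using C by (simp add: image_group_def)
  ultimately show ?thesis using splits by (simp add: splits_def)
qed

section \<open>Two test extensions\<close>

text \<open>
  The pushout of \<open>\<int> \<rightarrow> \<int>\<close>, multiplication by \<open>n\<close>, along the homomorphism \<open>\<int> \<rightarrow> A\<close> with \<open>1 \<mapsto> a\<close>.  It is
  written with the representatives \<open>0, \<dots>, n - 1\<close> for the second component, so that \<open>a\<close> is added whenever
  their addition produces a carry.
\<close>

definition carry_group :: "'a monoid \<Rightarrow> 'a \<Rightarrow> nat \<Rightarrow> ('a \<times> int) monoid"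
  where "carry_group A a n =
    \<lparr>carrier = carrier A \<times> {0..<int n},
     monoid.mult = (\<lambda>(x, i) (y, j).
       (x \<otimes>\<^bsub>A\<^esub> y \<otimes>\<^bsub>A\<^esub> a [^]\<^bsub>A\<^esub> ((i + j) div int n), (i + j) mod int n)),
     one = (\<one>\<^bsub>A\<^esub>, 0)\<rparr>"

lemma mem_carry_group:
  "(x, i) \<in> carrier (carry_group A a n) \<longleftrightarrow> x \<in> carrier A \<and> 0 \<le> i \<and> i < int n"
  by (simp add: carry_group_def)

text \<open>
  The cocycle identity for carries.
\<close>

lemma div_add_carry:
  fixes i j k :: int
  assumes "n > 0"
  shows "(i + j) div n + ((i + j) mod n + k) div n = (i + j + k) div n"
proof -
  have "i + j + k = ((i + j) mod n + k) + n * ((i + j) div n)" by simp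
  then show ?thesis using assms by (metis add.commute div_mult_self2 less_irrefl)
qed

lemma comm_group_carry_group:
  assumes A: "comm_group A" and a: "a \<in> carrier A" and n: "n > 0"
  shows "comm_group (carry_group A a n)"
proof (rule comm_groupI)
  interpret A: comm_group A by fact
  have mod: "0 \<le> i mod int n" "i mod int n < int n" for i using n by simp_all
  show "u \<otimes>\<^bsub>carry_group A a n\<^esub> v \<in> carrier (carry_group A a n)"
    if "u \<in> carrier (carry_group A a n)" "v \<in> carrier (carry_group A a n)" for u v
    using that a mod by (auto simp: carry_group_def)
  show "\<one>\<^bsub>carry_group A a n\<^esub> \<in> carrier (carry_group A a n)" using n by (simp add: carry_group_def)
  show "\<one>\<^bsub>carry_group A a n\<^esub> \<otimes>\<^bsub>carry_group A a n\<^esub> u = u" if "u \<in> carrier (carry_group A a n)" for u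
    using that by (auto simp: carry_group_def)
  show "u \<otimes>\<^bsub>carry_group A a n\<^esub> v = v \<otimes>\<^bsub>carry_group A a n\<^esub> u"
    if "u \<in> carrier (carry_group A a n)" "v \<in> carrier (carry_group A a n)" for u v
    using that a by (auto simp: carry_group_def A.m_comm add.commute)
  show "(u \<otimes>\<^bsub>carry_group A a n\<^esub> v) \<otimes>\<^bsub>carry_group A a n\<^esub> w =
      u \<otimes>\<^bsub>carry_group A a n\<^esub> (v \<otimes>\<^bsub>carry_group A a n\<^esub> w)"
    if u: "u \<in> carrier (carry_group A a n)" and v: "v \<in> carrier (carry_group A a n)"
      and w: "w \<in> carrier (carry_group A a n)" for u v w
  proof -
    obtain x i y j z k where eqs: "u = (x, i)" "v = (y, j)" "w = (z, k)" by (cases u, cases v, cases w)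
    have c: "x \<in> carrier A" "y \<in> carrier A" "z \<in> carrier A"
      using u v w by (simp_all add: eqs carry_group_def)
    let ?e = "\<lambda>m. a [^]\<^bsub>A\<^esub> (m :: int)"
    have e: "?e ((i + j) div int n) \<otimes>\<^bsub>A\<^esub> ?e (((i + j) mod int n + k) div int n) = ?e ((i + j + k) div int n)"
      using a n div_add_carry[of "int n" i j k] by (simp add: A.int_pow_mult[symmetric])
    have e': "?e ((j + k) div int n) \<otimes>\<^bsub>A\<^esub> ?e ((i + (j + k) mod int n) div int n) = ?e ((i + j + k) div int n)"
      using a n div_add_carry[of "int n" j k i] by (simp add: A.int_pow_mult[symmetric] add.commute add.left_commute)
    have "x \<otimes>\<^bsub>A\<^esub> y \<otimes>\<^bsub>A\<^esub> ?e ((i + j) div int n) \<otimes>\<^bsub>A\<^esub> z \<otimes>\<^bsub>A\<^esub> ?e (((i + j) mod int n + k) div int n)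
      = x \<otimes>\<^bsub>A\<^esub> y \<otimes>\<^bsub>A\<^esub> z \<otimes>\<^bsub>A\<^esub> (?e ((i + j) div int n) \<otimes>\<^bsub>A\<^esub> ?e (((i + j) mod int n + k) div int n))"
      using c a by (simp add: A.m_ac)
    also have "\<dots> = x \<otimes>\<^bsub>A\<^esub> y \<otimes>\<^bsub>A\<^esub> z \<otimes>\<^bsub>A\<^esub> (?e ((j + k) div int n) \<otimes>\<^bsub>A\<^esub> ?e ((i + (j + k) mod int n) div int n))"
      by (simp only: e e')
    also have "\<dots> = x \<otimes>\<^bsub>A\<^esub> (y \<otimes>\<^bsub>A\<^esub> z \<otimes>\<^bsub>A\<^esub> ?e ((j + k) div int n)) \<otimes>\<^bsub>A\<^esub> ?e ((i + (j + k) mod int n) div int n)"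
      using c a by (simp add: A.m_ac)
    finally show ?thesis
      by (simp add: eqs carry_group_def mod_add_left_eq mod_add_right_eq add.assoc)
  qed
  show "\<exists>v \<in> carrier (carry_group A a n). v \<otimes>\<^bsub>carry_group A a n\<^esub> u = \<one>\<^bsub>carry_group A a n\<^esub>"
    if u: "u \<in> carrier (carry_group A a n)" for u
  proof -
    obtain x i where xi: "u = (x, i)" "x \<in> carrier A" using u by (auto simp: carry_group_def)
    define j where "j = (- i) mod int n"
    have j: "(j + i) mod int n = 0" "0 \<le> j" "j < int n"
      using n by (simp_all add: j_def mod_add_left_eq)
    let ?e = "a [^]\<^bsub>A\<^esub> ((j + i) div int n)"
    have "inv\<^bsub>A\<^esub> (x \<otimes>\<^bsub>A\<^esub> ?e) \<otimes>\<^bsub>A\<^esub> x \<otimes>\<^bsub>A\<^esub> ?e = \<one>\<^bsub>A\<^esub>" using xi a by (simp add: A.m_assoc)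
    then show ?thesis
      using j xi a by (intro bexI[of _ "(inv\<^bsub>A\<^esub> (x \<otimes>\<^bsub>A\<^esub> ?e), j)"]) (simp_all add: carry_group_def)
  qed
qed

lemma extension_carry_group:
  assumes A: "comm_group A" and a: "a \<in> carrier A" and n: "n > 0"
  shows "extension (integer_mod_group n) A (carry_group A a n, \<lambda>x. (x, 0), snd)"
proof -
  interpret A: comm_group A by fact
  have "short_exact A (carry_group A a n) (integer_mod_group n) (\<lambda>x. (x, 0)) snd"
    unfolding short_exact_def
  proof (intro conjI)
    show "snd ` carrier (carry_group A a n) = carrier (integer_mod_group n)"
      using n A.one_closed by (force simp: carry_group_def carrier_integer_mod_group)
  qed (use n in \<open>auto simp: hom_def carry_group_def carrier_integer_mod_group kernel_def inj_on_def\<close>)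
  then show ?thesis using assms comm_group_carry_group by (simp add: extension_def)
qed

lemma carry_group_pow:
  assumes A: "comm_group A" and a: "a \<in> carrier A" and n: "n > 0"
  shows "(\<one>\<^bsub>A\<^esub>, i) [^]\<^bsub>carry_group A a n\<^esub> (m::nat) =
    (a [^]\<^bsub>A\<^esub> ((int m * i) div int n), (int m * i) mod int n)"
proof (induction m)
  case 0
  interpret A: comm_group A by fact
  show ?case by (simp add: carry_group_def)
next
  case (Suc m)
  interpret A: comm_group A by fact
  have "(\<one>\<^bsub>A\<^esub>, i) [^]\<^bsub>carry_group A a n\<^esub> Suc m =
      (a [^]\<^bsub>A\<^esub> ((int m * i) div int n) \<otimes>\<^bsub>A\<^esub> a [^]\<^bsub>A\<^esub> (((int m * i) mod int n + i) div int n),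
       ((int m * i) mod int n + i) mod int n)"
    using a by (simp add: Suc.IH) (simp add: carry_group_def)
  also have "\<dots> = (a [^]\<^bsub>A\<^esub> ((int (Suc m) * i) div int n), (int (Suc m) * i) mod int n)"
    using a n div_add_carry[of "int n" "int m * i" 0 i]
    by (simp add: A.int_pow_mult[symmetric] mod_add_left_eq mod_add_right_eq distrib_right add.commute)
  finally show ?case .
qed

text \<open>
  In \<open>carry_group A a n\<close> the element \<open>(1, 1)\<close> has \<open>n\<close>-th power \<open>(a, 0)\<close>, so a retraction to \<open>A\<close> sends
  it to an \<open>n\<close>-th root of \<open>a\<close>.  If \<open>a\<close> is a torsion element then so is \<open>(1, 1)\<close>, and the extension is a
  t-extension.
\<close>

lemma torsion_part_divisible_of_splits:
  assumes A: "comm_group A" and n: "n > 0" and a: "a \<in> carrier (torsion_part A)"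
    and splits: "\<And>E :: ('a, 'a \<times> int, int) extension.
      t_extension (integer_mod_group n) A E \<Longrightarrow> splits (A :: 'a monoid) E"
  shows "\<exists>y \<in> carrier A. y [^]\<^bsub>A\<^esub> n = a"
proof (cases "n = 1")
  case True
  interpret A: comm_group A by fact
  show ?thesis using True a by (auto simp: mem_torsion_part)
next
  case False
  interpret A: comm_group A by fact
  let ?B = "carry_group A a n"
  obtain k :: nat where k: "a \<in> carrier A" "k > 0" "a [^]\<^bsub>A\<^esub> k = \<one>\<^bsub>A\<^esub>"
    using a by (auto simp: mem_torsion_part)
  have E: "extension (integer_mod_group n) A (?B, \<lambda>x. (x, 0), snd)"
    using A k(1) n by (rule extension_carry_group)
  interpret comm_short_exact A ?B "integer_mod_group n" "\<lambda>x. (x, 0)" snd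
    using E by (simp add: extension_iff)
  have "i \<in> snd ` carrier (torsion_part ?B)" if i: "i \<in> carrier (integer_mod_group n)" for i
  proof -
    have "a [^]\<^bsub>A\<^esub> (int k * i) = \<one>\<^bsub>A\<^esub>"
      using k(1,3) by (metis A.int_pow_one A.int_pow_pow int_pow_int)
    moreover have "(int (n * k) * i) div int n = int k * i" "(int (n * k) * i) mod int n = 0"
      using n by (simp_all add: mult.assoc)
    ultimately have "(\<one>\<^bsub>A\<^esub>, i) [^]\<^bsub>?B\<^esub> (n * k) = \<one>\<^bsub>?B\<^esub>"
      unfolding carry_group_pow[OF A k(1) n] by (simp only: carry_group_def monoid.simps)
    moreover have "(\<one>\<^bsub>A\<^esub>, i) \<in> carrier ?B"
      using i n by (simp only: mem_carry_group) (simp add: carrier_integer_mod_group)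
    moreover have "n * k > 0" using n k(2) by simp
    ultimately have "(\<one>\<^bsub>A\<^esub>, i) \<in> carrier (torsion_part ?B)"
      unfolding mem_torsion_part by blast
    then show ?thesis by force
  qed
  then have "t_extension (integer_mod_group n) A (?B, \<lambda>x. (x, 0), snd)"
    using E by (auto simp: t_extension_iff mem_torsion_part)
  then have "splits A (?B, \<lambda>x. (x, 0), snd :: _ \<Rightarrow> int)" by (rule splits)
  then obtain r where r: "r \<in> hom ?B A" "\<And>x. x \<in> carrier A \<Longrightarrow> r (x, 0) = x"
    by (auto simp: splits_def)
  interpret r: group_hom ?B A r by unfold_locales (rule r)
  have one: "(\<one>\<^bsub>A\<^esub>, 1) \<in> carrier ?B" using False n by (simp only: mem_carry_group) simp
  have "(\<one>\<^bsub>A\<^esub>, 1) [^]\<^bsub>?B\<^esub> n = (a, 0)"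
    using n k(1) unfolding carry_group_pow[OF A k(1) n] by simp
  then have "r (\<one>\<^bsub>A\<^esub>, 1) [^]\<^bsub>A\<^esub> n = a" using r.hom_nat_pow[OF one, of n] r(2)[OF k(1)] by simp
  then show ?thesis using r.hom_closed[OF one] by blast
qed

lemma t_extension_of_torsion_free:
  assumes "extension C A E" and "torsion_free_group C"
  shows "t_extension C A E"
proof -
  obtain B \<phi> \<psi> where E: "E = (B, \<phi>, \<psi>)" by (cases E)
  interpret comm_short_exact A B C \<phi> \<psi> using assms(1) E by (simp add: extension_iff)
  have "\<one>\<^bsub>B\<^esub> \<in> carrier (torsion_part B)" by (auto simp: mem_torsion_part intro!: exI[of _ 1])
  then have "\<one>\<^bsub>C\<^esub> \<in> \<psi> ` carrier (torsion_part B)" using psi.hom_one by (metis imageI)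
  then show ?thesis
    using assms by (simp add: E t_extension_iff torsion_free_group_def)
qed

section \<open>Splitting off the torsion part\<close>

text \<open>
  By injectivity the divisible torsion part is a retract of \<open>A\<close>, and \<open>D\<close> is the kernel of the
  retraction.  An extension of the rationals by \<open>D\<close> becomes one by \<open>A\<close> after adding the torsion part
  as a direct summand; that one splits, hence so does the given one.
\<close>

lemma torsion_divisible_times_cotorsion_decomposition:
  fixes A :: "'a monoid"
  assumes A: "comm_group A" and cot: "cotorsion_group A"
    and div: "\<And>a n. a \<in> carrier (torsion_part A) \<Longrightarrow> (n::nat) > 0 \<Longrightarrow> \<exists>y \<in> carrier A. y [^]\<^bsub>A\<^esub> n = a"
  shows "\<exists>(B :: 'a monoid) (D :: 'a monoid). comm_group B \<and> comm_group D \<and>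
    torsion_group B \<and> divisible_group B \<and> torsion_free_group D \<and> cotorsion_group D \<and> A \<cong> B \<times>\<times> D"
proof -
  interpret A: comm_group A by fact
  let ?T = "torsion_part A"
  have T_eq: "?T = A\<lparr>carrier := carrier ?T\<rparr>" by (simp add: torsion_part_def)
  have T_sub: "subgroup (carrier ?T) A" using A by (rule subgroup_torsion_part)
  have T: "comm_group ?T" using subgroup_imp_comm_group[OF A T_sub] T_eq by simp
  interpret T: comm_group ?T by (rule T)
  have T_pow: "x [^]\<^bsub>?T\<^esub> n = x [^]\<^bsub>A\<^esub> n" for x and n :: nat
    using A.nat_pow_consistent[of x n "carrier ?T"] T_eq by simp
  have TA: "x \<in> carrier A" if "x \<in> carrier ?T" for x using that by (simp add: mem_torsion_part)
  have T_torsion: "torsion_group ?T"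
    by (auto simp: torsion_group_def mem_torsion_part T_pow)
  have T_div: "divisible_group ?T"
    unfolding divisible_group_def
  proof (intro ballI allI impI)
    fix a and n :: nat assume a: "a \<in> carrier ?T" and n: "n > 0"
    obtain y where y: "y \<in> carrier A" "y [^]\<^bsub>A\<^esub> n = a" using div[OF a n] by blast
    obtain k :: nat where k: "k > 0" "a [^]\<^bsub>A\<^esub> k = \<one>\<^bsub>A\<^esub>" using a by (auto simp: mem_torsion_part)
    have "y [^]\<^bsub>A\<^esub> (n * k) = \<one>\<^bsub>A\<^esub>" using y k by (simp add: A.nat_pow_pow[symmetric])
    then have "y \<in> carrier ?T" using y(1) n k(1) by (auto simp: mem_torsion_part intro!: exI[of _ "n * k"])
    then show "\<exists>y \<in> carrier ?T. y [^]\<^bsub>?T\<^esub> n = a" using y(2) T_pow by auto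
  qed
  have "(\<lambda>x. x) \<in> hom (A\<lparr>carrier := carrier ?T\<rparr>) ?T" by (simp add: hom_def)
  from divisible_group_injective[OF A T T_div T_sub this]
  obtain r where r: "r \<in> hom A ?T" "\<And>x. x \<in> carrier ?T \<Longrightarrow> r x = x" by blast
  interpret r: group_hom A ?T r by unfold_locales (rule r)
  have r_mult: "r (x \<otimes>\<^bsub>A\<^esub> y) = r x \<otimes>\<^bsub>A\<^esub> r y" if "x \<in> carrier A" "y \<in> carrier A" for x y
    using r.hom_mult[OF that] by simp
  have rA: "r x \<in> carrier A" if "x \<in> carrier A" for x using TA r.hom_closed[OF that] .
  have r_r: "r (r x) = r x" if "x \<in> carrier A" for x using r(2) r.hom_closed[OF that] .
  define D where "D = A\<lparr>carrier := kernel A ?T r\<rparr>"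
  have D: "comm_group D" unfolding D_def using A r.subgroup_kernel by (rule subgroup_imp_comm_group)
  interpret D: comm_group D by (rule D)
  have D_mem: "x \<in> carrier D \<longleftrightarrow> x \<in> carrier A \<and> r x = \<one>\<^bsub>A\<^esub>" for x by (simp add: D_def kernel_def)
  have D_simps [simp]: "monoid.mult D = monoid.mult A" "one D = one A" by (simp_all add: D_def)
  have D_pow: "x [^]\<^bsub>D\<^esub> n = x [^]\<^bsub>A\<^esub> n" for x and n :: nat
    using A.nat_pow_consistent[of x n "kernel A ?T r"] by (simp add: D_def)
  have D_tf: "torsion_free_group D"
    unfolding torsion_free_iff[OF D.is_group] D_pow
  proof (intro ballI allI impI)
    fix x and n :: nat assume "x \<in> carrier D" "n > 0" "x [^]\<^bsub>A\<^esub> n = \<one>\<^bsub>D\<^esub>"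
    then have "x \<in> carrier ?T" "r x = \<one>\<^bsub>A\<^esub>" by (auto simp: D_mem mem_torsion_part)
    then show "x = \<one>\<^bsub>D\<^esub>" using r(2) by simp
  qed
  define p where "p x = x \<otimes>\<^bsub>A\<^esub> inv\<^bsub>A\<^esub> r x" for x
  have T_inv: "inv\<^bsub>?T\<^esub> x = inv\<^bsub>A\<^esub> x" if "x \<in> carrier ?T" for x
    using A.m_inv_consistent[OF T_sub that] T_eq by simp
  have p_hom: "p \<in> hom A D"
    by (rule homI) (simp_all add: p_def D_mem rA r_mult r_r T_inv A.inv_mult A.m_ac)
  have p_id: "p x = x" if "x \<in> carrier D" for x using that by (simp add: p_def D_mem)
  have p_one: "p x = \<one>\<^bsub>A\<^esub>" if "x \<in> carrier ?T" for x using r(2)[OF that] TA[OF that] by (simp add: p_def)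
  have decomp: "r x \<otimes>\<^bsub>A\<^esub> p x = x" if "x \<in> carrier A" for x
    using that rA by (simp add: p_def A.m_lcomm)
  interpret p: group_hom A D p by unfold_locales (rule p_hom)
  have iso: "(\<lambda>x. (r x, p x)) \<in> iso A (?T \<times>\<times> D)"
  proof -
    have hom: "(\<lambda>x. (r x, p x)) \<in> hom A (?T \<times>\<times> D)"
      using r(1) p_hom by (simp add: hom_pairwise comp_def)
    interpret P: comm_group "?T \<times>\<times> D" using T D by (rule DirProd_comm_group)
    interpret rp: group_hom A "?T \<times>\<times> D" "\<lambda>x. (r x, p x)" by unfold_locales (rule hom)
    show ?thesis
      unfolding rp.iso_iff
    proof
      show "carrier (?T \<times>\<times> D) \<subseteq> (\<lambda>x. (r x, p x)) ` carrier A"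
      proof
        fix u assume "u \<in> carrier (?T \<times>\<times> D)"
        then obtain x d where u: "u = (x, d)" "x \<in> carrier ?T" "d \<in> carrier D" by auto
        have dA: "d \<in> carrier A" "r d = \<one>\<^bsub>A\<^esub>" using u(3) by (simp_all add: D_mem)
        have "r (x \<otimes>\<^bsub>A\<^esub> d) = x" using r_mult[OF TA[OF u(2)] dA(1)] r(2)[OF u(2)] dA TA[OF u(2)] by simp
        moreover have "p (x \<otimes>\<^bsub>A\<^esub> d) = d"
          using p.hom_mult[OF TA[OF u(2)] dA(1)] p_one[OF u(2)] p_id[OF u(3)] dA by simp
        ultimately show "u \<in> (\<lambda>x. (r x, p x)) ` carrier A"
          using u(1) TA[OF u(2)] dA(1) by (intro image_eqI[of _ _ "x \<otimes>\<^bsub>A\<^esub> d"]) simp_all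
      qed
      show "\<forall>x\<in>carrier A. (r x, p x) = \<one>\<^bsub>?T \<times>\<times> D\<^esub> \<longrightarrow> x = \<one>\<^bsub>A\<^esub>"
        using decomp by fastforce
    qed
  qed
  have "splits D E" if E: "extension rat_group D E" for E :: "('a, 'a \<times> rat, rat) extension"
  proof -
    obtain B \<phi> \<psi> where E_eq: "E = (B, \<phi>, \<psi>)" by (cases E)
    interpret comm_short_exact D B rat_group \<phi> \<psi> using E E_eq by (simp add: extension_iff)
    \<comment> \<open>The direct sum of the given extension and the trivial extension of \<open>0\<close> by the torsion part.\<close>
    let ?\<phi> = "\<lambda>x. (\<phi> (p x), r x)" and ?\<psi> = "\<lambda>(b, t :: 'a). \<psi> b"
    have phi_p: "\<phi> \<circ> p \<in> hom A B" using p_hom hom_phi by (rule hom_compose)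
    have inj: "x = y" if "x \<in> carrier A" "y \<in> carrier A" "\<phi> (p x) = \<phi> (p y)" "r x = r y" for x y
    proof -
      have "p x = p y" using that by (intro inj_onD[OF inj_phi]) simp_all
      then show ?thesis using decomp[OF that(1)] decomp[OF that(2)] that(4) by metis
    qed
    have "short_exact A (B \<times>\<times> ?T) rat_group ?\<phi> ?\<psi>"
      unfolding short_exact_def
    proof (intro conjI)
      show "?\<phi> \<in> hom A (B \<times>\<times> ?T)" using phi_p r(1) by (simp add: hom_pairwise comp_def)
      show "?\<psi> \<in> hom (B \<times>\<times> ?T) rat_group" using psi.hom_mult by (auto simp: hom_def)
      show "inj_on ?\<phi> (carrier A)" using inj by (auto intro: inj_onI)
      have "q \<in> ?\<psi> ` carrier (B \<times>\<times> ?T)" for q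
      proof -
        obtain b where "b \<in> carrier B" "\<psi> b = q" by (rule psi_surjE[of q]) simp
        then show ?thesis using T.one_closed by (intro image_eqI[of _ _ "(b, \<one>\<^bsub>A\<^esub>)"]) simp_all
      qed
      then show "?\<psi> ` carrier (B \<times>\<times> ?T) = carrier rat_group" unfolding rat_group_simps by blast
      show "?\<phi> ` carrier A = kernel (B \<times>\<times> ?T) rat_group ?\<psi>"
      proof (intro equalityI subsetI)
        fix u assume "u \<in> ?\<phi> ` carrier A"
        then show "u \<in> kernel (B \<times>\<times> ?T) rat_group ?\<psi>"
          using psi_phi by (auto simp: kernel_def)
      next
        fix u assume u: "u \<in> kernel (B \<times>\<times> ?T) rat_group ?\<psi>"
        then obtain b t where bt: "u = (b, t)" "b \<in> carrier B" "\<psi> b = \<one>\<^bsub>rat_group\<^esub>" "t \<in> carrier ?T"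
          by (auto simp: kernel_def)
        obtain d where d: "d \<in> carrier D" "b = \<phi> d" using bt(2,3) by (rule kernel_psiE)
        have "(t, d) \<in> (\<lambda>x. (r x, p x)) ` carrier A"
          using iso bt(4) d(1) by (auto simp: iso_def bij_betw_def)
        then show "u \<in> ?\<phi> ` carrier A" using bt(1) d(2) by auto
      qed
    qed
    then have "extension rat_group A (B \<times>\<times> ?T, ?\<phi>, ?\<psi>)"
      using A DirProd_comm_group[OF B.comm_group_axioms T] comm_group_rat_group
      by (simp add: extension_def)
    with cot have "splits A (B \<times>\<times> ?T, ?\<phi>, ?\<psi>)" by (rule cotorsion_group_splits)
    then obtain \<rho> where \<rho>: "\<rho> \<in> hom (B \<times>\<times> ?T) A" "\<And>x. x \<in> carrier A \<Longrightarrow> \<rho> (\<phi> (p x), r x) = x"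
      by (auto simp: splits_def)
    have "(\<lambda>b. (b, \<one>\<^bsub>A\<^esub>)) \<in> hom B (B \<times>\<times> ?T)"
      using T.one_closed by (auto simp: hom_def)
    from hom_compose[OF hom_compose[OF this \<rho>(1)] p_hom]
    have "(\<lambda>b. p (\<rho> (b, \<one>\<^bsub>A\<^esub>))) \<in> hom B D" by (simp add: comp_def)
    moreover have "p (\<rho> (\<phi> d, \<one>\<^bsub>A\<^esub>)) = d" if "d \<in> carrier D" for d
      using \<rho>(2)[of d] p_id[OF that] that by (simp add: D_mem)
    ultimately show ?thesis unfolding splits_def E_eq prod.case by (intro bexI ballI)
  qed
  then have "cotorsion_group D" using cotorsion_group_iff[OF D] by blast
  moreover have "A \<cong> ?T \<times>\<times> D" using iso by (auto simp: is_iso_def)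
  ultimately show ?thesis using T D T_torsion T_div D_tf by blast
qed

section \<open>The characterization\<close>

lemma decomposition_of_countable_splits:
  fixes A :: "'a monoid"
  assumes A: "comm_group A"
    and rat: "\<And>E :: ('a, 'a \<times> rat, rat) extension. t_extension rat_group A E \<Longrightarrow> splits A E"
    and cyclic: "\<And>(n::nat) (E :: ('a, 'a \<times> int, int) extension).
      t_extension (integer_mod_group n) A E \<Longrightarrow> splits A E"
  shows "\<exists>(B :: 'a monoid) (D :: 'a monoid). comm_group B \<and> comm_group D \<and>
    torsion_group B \<and> divisible_group B \<and> torsion_free_group D \<and> cotorsion_group D \<and> A \<cong> B \<times>\<times> D"
proof (rule torsion_divisible_times_cotorsion_decomposition[OF A])
  show "cotorsion_group A"
    unfolding cotorsion_group_iff[OF A]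
    using rat t_extension_of_torsion_free torsion_free_rat_group by blast
  show "\<exists>y \<in> carrier A. y [^]\<^bsub>A\<^esub> n = a" if "a \<in> carrier (torsion_part A)" "n > 0" for a and n :: nat
    using A that(2,1) cyclic by (rule torsion_part_divisible_of_splits)
qed

theorem theorem2p11:
  fixes A :: "'a monoid"
  assumes "comm_group A" and "infinite (UNIV :: 'u set)"
  shows "(t_injective TYPE('u) A \<longleftrightarrow>
            (\<forall>C :: 'u monoid. comm_group C \<longrightarrow> carrier (Ext_t C A) = {\<one>\<^bsub>Ext_t C A\<^esub>})) \<and>
         (t_injective TYPE('u) A \<longleftrightarrow>
            (\<exists>(B :: 'a monoid) (D :: 'a monoid). comm_group B \<and> comm_group D \<and>
               torsion_group B \<and> divisible_group B \<and>
               torsion_free_group D \<and> cotorsion_group D \<and>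
               A \<cong> B \<times>\<times> D))"
    (is "(?inj \<longleftrightarrow> ?ext) \<and> (?inj \<longleftrightarrow> ?dec)")
proof -
  \<comment> \<open>One hypothesis at two types, since the two test extensions have middle groups of different element types.\<close>
  have dec: ?dec
    if splits: "\<And>(C :: 'u monoid) (B :: ('a \<times> rat) monoid) \<phi> \<psi>. countable (carrier C) \<Longrightarrow>
        t_extension C A (B, \<phi>, \<psi>) \<Longrightarrow> splits A (B, \<phi>, \<psi>)"
      "\<And>(C :: 'u monoid) (B :: ('a \<times> int) monoid) \<phi> \<psi>. countable (carrier C) \<Longrightarrow>
        t_extension C A (B, \<phi>, \<psi>) \<Longrightarrow> splits A (B, \<phi>, \<psi>)"
  proof (rule decomposition_of_countable_splits[OF assms(1)])
    fix E :: "('a, 'a \<times> rat, rat) extension" assume E: "t_extension rat_group A E"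
    obtain B \<phi> \<psi> where eq: "E = (B, \<phi>, \<psi>)" by (cases E)
    show "splits A E"
      unfolding eq
      by (rule splits_of_splits_in_infinite_type[OF assms(2) countableI_type E[unfolded eq] splits(1)])
  next
    fix n :: nat and E :: "('a, 'a \<times> int, int) extension"
    assume E: "t_extension (integer_mod_group n) A E"
    obtain B \<phi> \<psi> where eq: "E = (B, \<phi>, \<psi>)" by (cases E)
    show "splits A E"
      unfolding eq
      by (rule splits_of_splits_in_infinite_type[OF assms(2) countableI_type E[unfolded eq] splits(2)])
  qed
  have "?dec" if ?inj
    by (rule dec) (rule t_injective_splits[OF that assms(2)]; assumption)+
  moreover have "?dec" if ?ext
  proof (rule dec)
    fix C :: "'u monoid" and B :: "('a \<times> rat) monoid" and \<phi> \<psi> assume t: "t_extension C A (B, \<phi>, \<psi>)"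
    then have "comm_group C" by (simp add: t_extension_def extension_def)
    then have "carrier (Ext_t C A) = {\<one>\<^bsub>Ext_t C A\<^esub>}" using that by simp
    then show "splits A (B, \<phi>, \<psi>)" using t by (rule Ext_t_trivial_splits)
  next
    fix C :: "'u monoid" and B :: "('a \<times> int) monoid" and \<phi> \<psi> assume t: "t_extension C A (B, \<phi>, \<psi>)"
    then have "comm_group C" by (simp add: t_extension_def extension_def)
    then have "carrier (Ext_t C A) = {\<one>\<^bsub>Ext_t C A\<^esub>}" using that by simp
    then show "splits A (B, \<phi>, \<psi>)" using t by (rule Ext_t_trivial_splits)
  qed
  moreover have "?inj \<and> ?ext" if ?dec
  proof
    from that obtain B D :: "'a monoid" where BD: "comm_group B" "divisible_group B"
      "comm_group D" "torsion_free_group D" "cotorsion_group D" "A \<cong> B \<times>\<times> D" by blast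
    note extends = torsion_divisible_times_cotorsion_extends[OF assms(1) BD]
    show ?inj unfolding t_injective_def using extends by blast
    show ?ext
    proof (intro allI impI)
      fix C :: "'u monoid" assume C: "comm_group C"
      have "splits A E" if t: "t_extension C A E" for E :: "('a, 'a \<times> 'u, 'u) extension"
      proof -
        obtain B' \<phi> \<psi> where E: "E = (B', \<phi>, \<psi>)" by (cases E)
        have "(\<lambda>a. a) \<in> hom A A" by (simp add: hom_def)
        from extends[OF t[unfolded E] this] show ?thesis by (simp add: splits_def E)
      qed
      then show "carrier (Ext_t C A) = {\<one>\<^bsub>Ext_t C A\<^esub>}" using Ext_t_trivial_iff[OF assms(1) C] by blast
    qed
  qed
  ultimately show ?thesis by blast
qed

end
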